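(* There exists a universal constant $C>0$ such that the following holds. For every integer $k\geq 3$ and every $n$ sufficiently large, there exists a graph $G_n$ with exactly $n$ vertices such that $c_b(G_n)=k$ and $$C\,\frac{n^{k+2}}{k^{k+2}}\leq \mathrm{capt}_b(G_n).$$
   Context: Bridge-burning cops and robbers is played on a finite graph $G$. First the cops choose their starting vertices, then the robber, knowing these, chooses his. Then cops and robber alternate turns, cops first; on the cops' turn each cop moves to an adjacent vertex or stays put, and on the robber's turn he moves to an adjacent vertex or stays put. Whenever the robber moves from a vertex $u$ to a vertex $v$, the edge $uv$ is erased from the graph (for both players, for the rest of the game). A round is a cop turn followed by the subsequent robber turn. The cops win (capture the robber) if some cop and the robber ever occupy the same vertex; the robber wins if he avoids capture forever. All positions are visible to both sides. The bridge-burning cop number $c_b(G)$ is the minimum number of cops that can guarantee capture on $G$. The bridge-burning capture time $\mathrm{capt}_b(G)$ is the minimum number of rounds within which $c_b(G)$ cops can guarantee capture on $G$ (the cops minimising and the robber maximising the length of the game). *)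

theory Defs
  imports Complex_Main "Graph_Theory.Pair_Digraph"
begin

text \<open>
  A finite simple graph is a \<^locale>\<open>pair_graph\<close>: an undirected edge joining u and v is the pair
  of opposite arcs (u, v), (v, u).

  A robber trajectory is a sequence R, where R t is the robber's vertex after t rounds; R 0 is his
  starting vertex.  Plays are continued formally after a capture, which is harmless since only the
  first capture matters and every player may always stay put.
\<close>

text \<open>
  The arcs of the edges traversed by the robber during the first t rounds.  When he stays put the
  pair is a loop, which is not an arc of a loopfree graph, so nothing is erased.
\<close>

definition burned :: "(nat \<Rightarrow> 'v) \<Rightarrow> nat \<Rightarrow> 'v rel" where
  "burned R t = (\<Union>s<t. {(R s, R (Suc s)), (R (Suc s), R s)})"

definition remaining :: "'v pair_pre_digraph \<Rightarrow> (nat \<Rightarrow> 'v) \<Rightarrow> nat \<Rightarrow> 'v rel" where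
  "remaining G R t = parcs G - burned R t"

definition robber_play :: "'v pair_pre_digraph \<Rightarrow> (nat \<Rightarrow> 'v) \<Rightarrow> bool" where
  "robber_play G R \<longleftrightarrow>
     R 0 \<in> pverts G \<and> (\<forall>t. R (Suc t) = R t \<or> (R t, R (Suc t)) \<in> remaining G R t)"

text \<open>
  A strategy S maps the robber's history to the cops' next positions, S h i being the position
  of cop number i.  The empty history gives the starting positions, and the history
  [R 0, ..., R t] gives the positions after the cops' turn of round t + 1.  The cops' own past
  moves are determined by S and the history, so they need not be recorded.
\<close>

type_synonym 'v cop_strategy = "'v list \<Rightarrow> nat \<Rightarrow> 'v"

text \<open>The cops' positions after their turn in round t (after their initial placement if t = 0).\<close>

definition cop_pos :: "'v cop_strategy \<Rightarrow> (nat \<Rightarrow> 'v) \<Rightarrow> nat \<Rightarrow> nat \<Rightarrow> 'v" where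
  "cop_pos S R t = S (map R [0..<t])"

definition legal_strategy :: "'v pair_pre_digraph \<Rightarrow> nat \<Rightarrow> 'v cop_strategy \<Rightarrow> bool" where
  "legal_strategy G k S \<longleftrightarrow>
     (\<forall>i<k. S [] i \<in> pverts G) \<and>
     (\<forall>R. robber_play G R \<longrightarrow>
        (\<forall>t. \<forall>i<k. cop_pos S R (Suc t) i = cop_pos S R t i \<or>
                  (cop_pos S R t i, cop_pos S R (Suc t) i) \<in> remaining G R t))"

text \<open>
  Within T rounds the robber is captured either after the placement or his own turn of round
  t (first disjunct), or during the cops' turn of round t + 1, while he is still at R t.
\<close>

definition captured_within :: "nat \<Rightarrow> 'v cop_strategy \<Rightarrow> (nat \<Rightarrow> 'v) \<Rightarrow> nat \<Rightarrow> bool" where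
  "captured_within k S R T \<longleftrightarrow>
     (\<exists>i<k. (\<exists>t\<le>T. cop_pos S R t i = R t) \<or> (\<exists>t<T. cop_pos S R (Suc t) i = R t))"

definition cops_win :: "'v pair_pre_digraph \<Rightarrow> nat \<Rightarrow> bool" where
  "cops_win G k \<longleftrightarrow>
     (\<exists>S. legal_strategy G k S \<and> (\<forall>R. robber_play G R \<longrightarrow> (\<exists>T. captured_within k S R T)))"

definition cops_win_within :: "'v pair_pre_digraph \<Rightarrow> nat \<Rightarrow> nat \<Rightarrow> bool" where
  "cops_win_within G k T \<longleftrightarrow>
     (\<exists>S. legal_strategy G k S \<and> (\<forall>R. robber_play G R \<longrightarrow> captured_within k S R T))"

definition cop_number :: "'v pair_pre_digraph \<Rightarrow> nat" where
  "cop_number G = (LEAST k. cops_win G k)"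

definition capture_time :: "'v pair_pre_digraph \<Rightarrow> nat" where
  "capture_time G = (LEAST T. cops_win_within G (cop_number G) T)"

end

theory Submission
  imports Defs "HOL-Library.Countable" "HOL-Number_Theory.Cong"
begin

text \<open>
  The k cops live on k disjoint tracks with about n/k vertices each.  The robber sits on one side
  of a complete bipartite graph on spots, and every spot is joined to exit vertices.  An exit
  leads to a pendant vertex, on which the robber is isolated once he has burned his way there; so
  the cops must, after every turn, occupy a vertex of each of the sets guarding the exits.  These sets
  are arranged so that there is one cop on each track and so that the cops can only move like the
  digits of a reflected Gray code with base about n/k.  At either end of the code, of length about
  (n/k)^k, they threaten the spots of one side, and the robber answers by moving along one edge to
  the other side.  As he can follow a trail with about (n/k)^2 edges, he survives for about
  (n/k)^(k+2) rounds, while the cops win by running through the code over and over.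

  For a digit to change, the next lower track must be at an end of its range and display there the
  residue (mod 2k) of the edge between leaves to be used.  As leaves of a track are adjacent only
  via its hubs, and a hub serves k consecutive edges, this costs only O(n/k^2) hubs per track but
  makes every digit change pass through a hub, which is allowed only during the display.
\<close>


section \<open>The game in terms of positions\<close>

text \<open>The constant is universal while the base is raised to the power \<open>k + 2\<close>, so
  the length \<open>m\<close> of a track has to be n/(k + O(1)): a fixed factor lost in
  \<open>m\<close> would cost a factor exponential in \<open>k\<close>. This rules out one hub for
  every edge between leaves, which would double the tracks. With \<open>k\<close> edges per hub, all
  hubs together number about \<open>m\<close>; tracks, hubs and two sides of \<open>m\<close> spots
  make \<open>(k + 3) * m\<close> vertices, up to a term in \<open>k\<close> alone.

  Guards restrict the positions after a cop turn, never the moves themselves. A change of digit must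
  therefore have an intermediate position of its own, the hub, to which a guard can refer.

  The cops may also idle or turn back, and while a track is at an end the tracks below it may move
  freely. So the lower bound does not follow the code itself; it uses an integer potential that
  changes by at most 1 per round and takes its two extreme values at the two threats.\<close>

definition cop_move :: "'v rel \<Rightarrow> nat \<Rightarrow> (nat \<Rightarrow> 'v) \<Rightarrow> (nat \<Rightarrow> 'v) \<Rightarrow> bool" where
  "cop_move E k P P' \<longleftrightarrow> (\<forall>i<k. P' i = P i \<or> (P i, P' i) \<in> E)"

definition burn :: "'v rel \<Rightarrow> 'v \<Rightarrow> 'v \<Rightarrow> 'v rel" where
  "burn B r r' = B \<union> {(r, r'), (r', r)}"

definition caught :: "nat \<Rightarrow> (nat \<Rightarrow> 'v) \<Rightarrow> 'v \<Rightarrow> bool" where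
  "caught k P r \<longleftrightarrow> (\<exists>i<k. P i = r)"

lemma burned_0 [simp]: "burned R 0 = {}"
  by (simp add: burned_def)

lemma burned_Suc: "burned R (Suc t) = burn (burned R t) (R t) (R (Suc t))"
  by (auto simp: burned_def burn_def less_Suc_eq)

lemma burned_cong: "(\<And>s. s \<le> t \<Longrightarrow> R s = R' s) \<Longrightarrow> burned R t = burned R' t"
  by (auto simp: burned_def)

lemma cop_pos_cong: "(\<And>s. s < t \<Longrightarrow> R s = R' s) \<Longrightarrow> cop_pos S R t = cop_pos S R' t"
  by (auto simp: cop_pos_def intro!: arg_cong[where f = S])

lemma legal_strategy_cop_move:
  "legal_strategy G k S \<longleftrightarrow> (\<forall>i<k. S [] i \<in> pverts G) \<and>
     (\<forall>R. robber_play G R \<longrightarrow>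
        (\<forall>t. cop_move (parcs G - burned R t) k (cop_pos S R t) (cop_pos S R (Suc t))))"
  by (simp add: legal_strategy_def cop_move_def remaining_def)

section \<open>Positions won by the cops within a given number of rounds\<close>

primrec win :: "'v pair_pre_digraph \<Rightarrow> nat \<Rightarrow> nat \<Rightarrow> (nat \<Rightarrow> 'v) \<Rightarrow> 'v \<Rightarrow> 'v rel \<Rightarrow> bool" where
  "win G k 0 P r B \<longleftrightarrow> caught k P r"
| "win G k (Suc n) P r B \<longleftrightarrow> caught k P r \<or>
     (\<exists>P'. cop_move (parcs G - B) k P P' \<and>
       (caught k P' r \<or> (\<forall>r'. r' = r \<or> (r, r') \<in> parcs G - B \<longrightarrow> win G k n P' r' (burn B r r'))))"

text \<open>A strategy sees only the robber's history, so \<open>st\<close> recurses over the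
  reversed history: the tail gives the cops' previous positions, and its length the number of rounds
  still available.\<close>

lemma cops_win_within_if_win:
  fixes G :: "'v pair_pre_digraph"
  assumes P0: "\<forall>i<k. P0 i \<in> pverts G" and win0: "\<forall>r\<in>pverts G. win G k T P0 r {}"
  shows "cops_win_within G k T"
proof -
  \<comment> \<open>Satisfiable in every position, by staying put where the position is not won:
    legality is demanded against all plays, also after a capture and after round
    \<open>T\<close>.\<close>
  define good where "good n P r B P' \<longleftrightarrow> cop_move (parcs G - B) k P P' \<and>
      (win G k (Suc n) P r B \<longrightarrow> caught k P r \<or> caught k P' r \<or>
        (\<forall>r'. r' = r \<or> (r, r') \<in> parcs G - B \<longrightarrow> win G k n P' r' (burn B r r')))" for n P r B P'
  define mv where "mv n P r B = (SOME P'. good n P r B P')" for n P r B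
  have "\<exists>P'. good n P r B P'" for n P r B
  proof (cases "win G k (Suc n) P r B \<and> \<not> caught k P r")
    case True
    then show ?thesis unfolding good_def win.simps by blast
  next
    case False
    then show ?thesis by (intro exI[of _ P]) (auto simp: good_def cop_move_def)
  qed
  then have mv: "good n P r B (mv n P r B)" for n P r B
    unfolding mv_def by (rule someI_ex)
  define st where "st = rec_list P0 (\<lambda>r h P. mv (T - Suc (length h)) P r
      (burned (\<lambda>i. rev (r # h) ! i) (length h)))"
  define S where "S h = st (rev h)" for h
  have S0: "cop_pos S R 0 = P0" for R
    by (simp add: cop_pos_def S_def st_def)
  have SS: "cop_pos S R (Suc t) = mv (T - Suc t) (cop_pos S R t) (R t) (burned R t)" for R t
  proof -
    have "burned (\<lambda>i. map R [0..<Suc t] ! i) t = burned R t"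
      by (rule burned_cong) (simp del: upt_Suc)
    then show ?thesis
      by (simp add: cop_pos_def S_def st_def)
  qed
  have "legal_strategy G k S"
    unfolding legal_strategy_cop_move
  proof (intro conjI allI impI)
    show "S [] i \<in> pverts G" if "i < k" for i
      using that P0 by (simp add: S_def st_def)
    show "cop_move (parcs G - burned R t) k (cop_pos S R t) (cop_pos S R (Suc t))" for R t
      using mv unfolding SS good_def by blast
  qed
  moreover have "captured_within k S R T" if R: "robber_play G R" for R
  proof (rule ccontr)
    assume nc: "\<not> captured_within k S R T"
    have nc1: "\<not> caught k (cop_pos S R t) (R t)" if "t \<le> T" for t
      using nc that by (auto simp: captured_within_def caught_def)
    have nc2: "\<not> caught k (cop_pos S R (Suc t)) (R t)" if "t < T" for t
      using nc that by (auto simp: captured_within_def caught_def)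
    have "t \<le> T \<Longrightarrow> win G k (T - t) (cop_pos S R t) (R t) (burned R t)" for t
    proof (induction t)
      case 0
      then show ?case using win0 R by (simp add: S0 robber_play_def)
    next
      case (Suc t)
      then have "win G k (Suc (T - Suc t)) (cop_pos S R t) (R t) (burned R t)"
        by (simp add: Suc_diff_Suc)
      moreover have "good (T - Suc t) (cop_pos S R t) (R t) (burned R t) (cop_pos S R (Suc t))"
        by (simp add: SS mv)
      moreover have "R (Suc t) = R t \<or> (R t, R (Suc t)) \<in> parcs G - burned R t"
        using R by (auto simp: robber_play_def remaining_def)
      ultimately have "win G k (T - Suc t) (cop_pos S R (Suc t)) (R (Suc t))
          (burn (burned R t) (R t) (R (Suc t)))"
        using nc1[of t] nc2[of t] Suc.prems unfolding good_def by fastforce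
      then show ?case by (simp add: burned_Suc)
    qed
    from this[of T] nc1[of T] show False by simp
  qed
  ultimately show ?thesis by (auto simp: cops_win_within_def)
qed

lemma win_Suc: "win G k n P r B \<Longrightarrow> win G k (Suc n) P r B"
proof (induction n arbitrary: P r B)
  case (Suc n)
  from Suc.prems consider "caught k P r"
    | P' where "cop_move (parcs G - B) k P P'" "caught k P' r"
    | P' where "cop_move (parcs G - B) k P P'"
        "\<forall>r'. r' = r \<or> (r, r') \<in> parcs G - B \<longrightarrow> win G k n P' r' (burn B r r')"
    unfolding win.simps by blast
  then show ?case
  proof cases
    case 3
    then have "\<forall>r'. r' = r \<or> (r, r') \<in> parcs G - B \<longrightarrow> win G k (Suc n) P' r' (burn B r r')"
      using Suc.IH by blast
    with 3 show ?thesis unfolding win.simps(2)[of G k "Suc n"] by blast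
  qed (auto simp: win.simps(2)[of G k "Suc n"] simp del: win.simps)
qed auto

lemma win_mono: "win G k n P r B \<Longrightarrow> n \<le> n' \<Longrightarrow> win G k n' P r B"
  by (rotate_tac 1, induction n' rule: dec_induct) (auto intro: win_Suc simp del: win.simps)

definition wins :: "'v pair_pre_digraph \<Rightarrow> nat \<Rightarrow> (nat \<Rightarrow> 'v) \<Rightarrow> 'v \<Rightarrow> 'v rel \<Rightarrow> bool" where
  "wins G k P r B \<longleftrightarrow> (\<exists>n. win G k n P r B)"

text \<open>The robber has finitely many replies, so individual bounds on the number of rounds
  combine into a common one.\<close>

lemma win_uniform:
  assumes "finite A" "\<forall>r\<in>A. \<exists>n. win G k n P r (f r)"
  shows "\<exists>n. \<forall>r\<in>A. win G k n P r (f r)"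
proof -
  from bchoice[OF assms(2)] obtain N where N: "\<forall>r\<in>A. win G k (N r) P r (f r)" ..
  have "\<forall>r\<in>A. win G k (Max (N ` A)) P r (f r)"
  proof
    fix r assume "r \<in> A"
    moreover from this have "N r \<le> Max (N ` A)" using assms(1) by simp
    ultimately show "win G k (Max (N ` A)) P r (f r)" using N win_mono by metis
  qed
  then show ?thesis ..
qed

lemma wins_catch:
  assumes "i < k" "P i = r \<or> (P i, r) \<in> parcs G - B"
  shows "wins G k P r B"
proof -
  have "cop_move (parcs G - B) k P (P(i := r))" "caught k (P(i := r)) r"
    using assms by (auto simp: cop_move_def caught_def)
  then have "win G k (Suc 0) P r B" unfolding win.simps by blast
  then show ?thesis unfolding wins_def by (rule exI)
qed

lemma wins_move:
  assumes fin: "finite (parcs G)" and mv: "cop_move (parcs G - B) k P P'"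
    and reply: "\<And>r'. r' = r \<or> (r, r') \<in> parcs G - B \<Longrightarrow> wins G k P' r' (burn B r r')"
  shows "wins G k P r B"
proof -
  let ?A = "{r'. r' = r \<or> (r, r') \<in> parcs G - B}"
  have "?A \<subseteq> insert r (snd ` parcs G)" by force
  then have "finite ?A" using fin by (auto intro: finite_subset)
  moreover have "\<forall>r'\<in>?A. \<exists>n. win G k n P' r' (burn B r r')"
    using reply unfolding wins_def by blast
  ultimately have "\<exists>n. \<forall>r'\<in>?A. win G k n P' r' (burn B r r')" by (rule win_uniform)
  then obtain n where "\<forall>r'\<in>?A. win G k n P' r' (burn B r r')" ..
  then have "win G k (Suc n) P r B" using mv unfolding win.simps by blast
  then show ?thesis unfolding wins_def by (rule exI)
qed

lemma cops_win_within_if_wins: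
  assumes "finite (pverts G)" "\<forall>i<k. P0 i \<in> pverts G" "\<And>r. r \<in> pverts G \<Longrightarrow> wins G k P0 r {}"
  shows "\<exists>T. cops_win_within G k T"
proof -
  have "\<forall>r\<in>pverts G. \<exists>n. win G k n P0 r {}"
    using assms(3) by (simp add: wins_def)
  from win_uniform[OF assms(1) this] obtain T where "\<forall>r\<in>pverts G. win G k T P0 r {}" by blast
  with assms(2) show ?thesis by (blast intro: cops_win_within_if_win)
qed

section \<open>Construction of robber plays\<close>

text \<open>The legality of \<open>S\<close> is known only against complete robber plays, so a
  finite history cannot simply be prolonged. The approximation number t is a complete play that
  stands still after round t; successive approximations agree on longer and longer initial segments,
  and the diagonal is the desired play.\<close>

lemma evading_play:
  fixes G :: "'v pair_pre_digraph"
  assumes S: "legal_strategy G k S"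
    and start: "\<exists>r\<in>pverts G. Inv 0 (S []) r {}"
    and step: "\<And>t P r B P'. \<lbrakk>Inv t P r B; cop_move (parcs G - B) k P P'\<rbrakk> \<Longrightarrow>
       \<exists>r'. (r' = r \<or> (r, r') \<in> parcs G - B) \<and> Inv (Suc t) P' r' (burn B r r')"
  shows "\<exists>R. robber_play G R \<and> (\<forall>t. Inv t (cop_pos S R t) (R t) (burned R t))"
proof -
  define ok where "ok t x \<longleftrightarrow> robber_play G x \<and> (\<forall>s>t. x s = x t) \<and>
      Inv t (cop_pos S x t) (x t) (burned x t)" for t x
  have "\<exists>f. \<forall>t. ok t (f t) \<and> (\<forall>s\<le>t. f (Suc t) s = f t s)"
  proof (rule dependent_nat_choice)
    from start obtain r where "r \<in> pverts G" "Inv 0 (S []) r {}" ..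
    then show "\<exists>x. ok 0 x"
      by (intro exI[of _ "\<lambda>_. r"]) (auto simp: ok_def robber_play_def cop_pos_def)
  next
    fix x t assume x: "ok t x"
    then have inv: "Inv t (cop_pos S x t) (x t) (burned x t)" by (simp add: ok_def)
    have mv: "cop_move (parcs G - burned x t) k (cop_pos S x t) (cop_pos S x (Suc t))"
      using S x by (auto simp: legal_strategy_cop_move ok_def)
    from step[OF inv mv]
    obtain r' where r': "r' = x t \<or> (x t, r') \<in> parcs G - burned x t"
      "Inv (Suc t) (cop_pos S x (Suc t)) r' (burn (burned x t) (x t) r')"
      by (elim exE conjE)
    define y where "y s = (if s \<le> t then x s else r')" for s
    have yx: "y s = x s" if "s \<le> t" for s using that by (simp add: y_def)
    have yt: "y s = r'" if "s > t" for s using that by (simp add: y_def)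
    have byx: "burned y s = burned x s" if "s \<le> t" for s
      using that by (intro burned_cong) (simp add: yx)
    have "robber_play G y"
      unfolding robber_play_def
    proof (intro conjI allI)
      show "y 0 \<in> pverts G" using x by (simp add: yx ok_def robber_play_def)
      fix s
      have "x (Suc s) = x s \<or> (x s, x (Suc s)) \<in> remaining G x s"
        using x by (auto simp: ok_def robber_play_def)
      then show "y (Suc s) = y s \<or> (y s, y (Suc s)) \<in> remaining G y s"
        using r'(1) by (cases s t rule: linorder_cases) (auto simp: yx yt byx remaining_def)
    qed
    moreover have "cop_pos S y (Suc t) = cop_pos S x (Suc t)"
      by (rule cop_pos_cong) (simp add: yx)
    ultimately have "ok (Suc t) y"
      using r'(2) by (simp add: ok_def yt burned_Suc yx byx)
    then show "\<exists>y. ok (Suc t) y \<and> (\<forall>s\<le>t. y s = x s)" using yx by (intro exI[of _ y]) simp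
  qed
  then obtain f where "\<forall>t. ok t (f t) \<and> (\<forall>s\<le>t. f (Suc t) s = f t s)" ..
  then have f: "ok t (f t)" "s \<le> t \<Longrightarrow> f (Suc t) s = f t s" for s t by simp_all
  define R where "R t = f t t" for t
  have fR: "s \<le> t \<Longrightarrow> f t s = R s" for s t
    by (induction t) (auto simp: R_def le_Suc_eq f(2))
  have bR: "burned (f t) s = burned R s" if "s \<le> t" for s t
    using that by (intro burned_cong) (simp add: fR)
  have "robber_play G R"
    unfolding robber_play_def
  proof (intro conjI allI)
    show "R 0 \<in> pverts G" using f(1)[of 0] by (simp add: R_def ok_def robber_play_def)
    fix t
    have "f (Suc t) (Suc t) = f (Suc t) t \<or> (f (Suc t) t, f (Suc t) (Suc t)) \<in> remaining G (f (Suc t)) t"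
      using f(1)[of "Suc t"] by (auto simp: ok_def robber_play_def)
    then show "R (Suc t) = R t \<or> (R t, R (Suc t)) \<in> remaining G R t"
      by (simp add: fR bR remaining_def)
  qed
  moreover have "Inv t (cop_pos S R t) (R t) (burned R t)" for t
  proof -
    have "cop_pos S (f t) t = cop_pos S R t"
      by (rule cop_pos_cong) (simp add: fR)
    then show ?thesis using f(1)[of t] by (simp add: ok_def fR bR)
  qed
  ultimately show ?thesis by (intro exI[of _ R]) simp
qed

lemma evasion:
  assumes S: "legal_strategy G k S"
    and start: "\<exists>r\<in>pverts G. Inv 0 (S []) r {}"
    and step: "\<And>t P r B P'. \<lbrakk>Inv t P r B; t < T; cop_move (parcs G - B) k P P'\<rbrakk> \<Longrightarrow>
       \<not> caught k P' r \<and>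
       (\<exists>r'. (r' = r \<or> (r, r') \<in> parcs G - B) \<and> Inv (Suc t) P' r' (burn B r r'))"
    and free: "\<And>t P r B. Inv t P r B \<Longrightarrow> \<not> caught k P r"
  shows "\<exists>R. robber_play G R \<and> \<not> captured_within k S R T"
proof -
  let ?Inv = "\<lambda>t P r B. t \<le> T \<longrightarrow> Inv t P r B"
  have "\<exists>R. robber_play G R \<and> (\<forall>t. ?Inv t (cop_pos S R t) (R t) (burned R t))"
  proof (rule evading_play[OF S])
    show "\<exists>r\<in>pverts G. ?Inv 0 (S []) r {}" using start by simp
    fix t P r B P'
    assume "?Inv t P r B" "cop_move (parcs G - B) k P P'"
    then show "\<exists>r'. (r' = r \<or> (r, r') \<in> parcs G - B) \<and> ?Inv (Suc t) P' r' (burn B r r')"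
      using step[of t P r B P'] by (cases "t < T") auto
  qed
  then obtain R where R: "robber_play G R"
    "\<And>t. t \<le> T \<Longrightarrow> Inv t (cop_pos S R t) (R t) (burned R t)" by blast
  have "\<not> caught k (cop_pos S R (Suc t)) (R t)" if "t < T" for t
    using step[OF R(2) that] S R(1) that by (auto simp: legal_strategy_cop_move)
  moreover have "\<not> caught k (cop_pos S R t) (R t)" if "t \<le> T" for t
    using free[OF R(2)[OF that]] .
  ultimately have "\<not> captured_within k S R T"
    by (auto simp: captured_within_def caught_def)
  with R(1) show ?thesis by blast
qed

lemma cops_win_if_within: "cops_win_within G k T \<Longrightarrow> cops_win G k"
  by (auto simp: cops_win_within_def cops_win_def)

section \<open>Relabelling of vertices\<close>

definition image_graph :: "('v \<Rightarrow> 'w) \<Rightarrow> 'v pair_pre_digraph \<Rightarrow> 'w pair_pre_digraph" where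
  "image_graph f G = \<lparr>pverts = f ` pverts G, parcs = map_prod f f ` parcs G\<rparr>"

lemma robber_play_in_pverts:
  assumes "robber_play G R" "parcs G \<subseteq> pverts G \<times> pverts G"
  shows "R t \<in> pverts G"
proof (induction t)
  case (Suc t)
  have "R (Suc t) = R t \<or> (R t, R (Suc t)) \<in> parcs G"
    using assms(1) by (auto simp: robber_play_def remaining_def)
  then show ?case using Suc assms(2) by auto
qed (use assms(1) in \<open>simp add: robber_play_def\<close>)

text \<open>Allows the structured vertices of the construction to be replaced by natural numbers.
  The cops pull the robber's play back along \<open>g\<close>, answer it in \<open>G\<close>, and
  carry the answer over by \<open>f\<close>.\<close>

lemma strategy_image_graph:
  fixes G :: "'v pair_pre_digraph" and f :: "'v \<Rightarrow> 'w"
  assumes inj: "inj_on f (pverts G)" and wf: "parcs G \<subseteq> pverts G \<times> pverts G"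
    and S: "legal_strategy G k S"
  shows "\<exists>S'. legal_strategy (image_graph f G) k S' \<and>
    (\<forall>R'. robber_play (image_graph f G) R' \<longrightarrow>
       (\<exists>R. robber_play G R \<and> (\<forall>T. captured_within k S R T \<longrightarrow> captured_within k S' R' T)))"
proof -
  let ?G' = "image_graph f G"
  define g where "g = inv_into (pverts G) f"
  have gf: "g (f v) = v" if "v \<in> pverts G" for v using that inj by (simp add: g_def)
  define S' where "S' h i = f (S (map g h) i)" for h i
  have pos: "cop_pos S' R' t = f \<circ> cop_pos S (g \<circ> R') t" for R' t
    by (auto simp: cop_pos_def S'_def)
  have *: "robber_play G (g \<circ> R') \<and> (\<forall>t. f (g (R' t)) = R' t) \<and>
      (\<forall>t u v. (u, v) \<in> remaining G (g \<circ> R') t \<longrightarrow> (f u, f v) \<in> remaining ?G' R' t)"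
    if R': "robber_play ?G' R'" for R'
  proof -
    have "parcs ?G' \<subseteq> pverts ?G' \<times> pverts ?G'" using wf by (auto simp: image_graph_def)
    then have V': "R' t \<in> f ` pverts G" for t
      using robber_play_in_pverts[OF R'] by (simp add: image_graph_def)
    have fg: "f (g (R' t)) = R' t" for t
      using V'[of t] by (auto simp: gf)
    have gV: "g (R' t) \<in> pverts G" for t
      using V'[of t] by (auto simp: gf)
    have bur: "(u, v) \<in> burned (g \<circ> R') t \<longleftrightarrow> (f u, f v) \<in> burned R' t"
      if "u \<in> pverts G" "v \<in> pverts G" for u v t
      using that fg gV gf by (fastforce simp: burned_def)
    have rem: "(u, v) \<in> remaining G (g \<circ> R') t \<Longrightarrow> (f u, f v) \<in> remaining ?G' R' t" for u v t
      using wf bur[of u v t] by (force simp: remaining_def image_graph_def)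
    have rem': "(g (R' t), g (R' (Suc t))) \<in> remaining G (g \<circ> R') t"
      if A: "(R' t, R' (Suc t)) \<in> remaining ?G' R' t" for t
    proof -
      from A obtain u v where uv: "(u, v) \<in> parcs G" "R' t = f u" "R' (Suc t) = f v"
        by (auto simp: remaining_def image_graph_def)
      with wf have "u \<in> pverts G" "v \<in> pverts G" by auto
      with uv A bur[of u v t] show ?thesis by (simp add: remaining_def gf)
    qed
    have "robber_play G (g \<circ> R')"
      using R' rem' gV unfolding robber_play_def by (metis comp_apply)
    with fg rem show ?thesis by blast
  qed
  have "legal_strategy ?G' k S'"
    unfolding legal_strategy_def
  proof (intro conjI allI impI)
    fix i assume "i < k"
    then show "S' [] i \<in> pverts ?G'"
      using S by (auto simp: S'_def image_graph_def legal_strategy_def)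
  next
    fix R' t i assume R': "robber_play ?G' R'" and i: "i < k"
    have "cop_pos S (g \<circ> R') (Suc t) i = cop_pos S (g \<circ> R') t i \<or>
      (cop_pos S (g \<circ> R') t i, cop_pos S (g \<circ> R') (Suc t) i) \<in> remaining G (g \<circ> R') t"
      using S *[OF R'] i by (auto simp: legal_strategy_def)
    then show "cop_pos S' R' (Suc t) i = cop_pos S' R' t i \<or>
      (cop_pos S' R' t i, cop_pos S' R' (Suc t) i) \<in> remaining ?G' R' t"
      using *[OF R'] by (auto simp: pos)
  qed
  moreover have "captured_within k S (g \<circ> R') T \<Longrightarrow> captured_within k S' R' T"
    if "robber_play ?G' R'" for R' T
    using *[OF that] unfolding captured_within_def pos by (metis comp_apply)
  ultimately show ?thesis using * by blast
qed

lemma cops_win_image_graph1: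
  assumes "inj_on f (pverts G)" "parcs G \<subseteq> pverts G \<times> pverts G"
  shows "cops_win G k \<Longrightarrow> cops_win (image_graph f G) k"
    and "cops_win_within G k T \<Longrightarrow> cops_win_within (image_graph f G) k T"
  using strategy_image_graph[OF assms] unfolding cops_win_def cops_win_within_def by meson+

lemma cops_win_image_graph:
  assumes inj: "inj_on f (pverts G)" and wf: "parcs G \<subseteq> pverts G \<times> pverts G"
  shows "cops_win (image_graph f G) k \<longleftrightarrow> cops_win G k"
    and "cops_win_within (image_graph f G) k T \<longleftrightarrow> cops_win_within G k T"
proof -
  let ?g = "inv_into (pverts G) f"
  have inj': "inj_on ?g (pverts (image_graph f G))"
    by (simp add: image_graph_def inj_on_inv_into)
  have wf': "parcs (image_graph f G) \<subseteq> pverts (image_graph f G) \<times> pverts (image_graph f G)"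
    using wf by (auto simp: image_graph_def)
  have "?g ` f ` pverts G = pverts G"
    using inj by (simp add: inv_into_image_cancel)
  moreover have "map_prod ?g ?g ` map_prod f f ` parcs G = parcs G"
    unfolding image_image using wf inj by (force simp: image_iff)
  ultimately have inverse: "image_graph ?g (image_graph f G) = G"
    by (simp add: image_graph_def)
  show "cops_win (image_graph f G) k \<longleftrightarrow> cops_win G k"
    using cops_win_image_graph1(1)[OF inj wf] cops_win_image_graph1(1)[OF inj' wf'] inverse by metis
  show "cops_win_within (image_graph f G) k T \<longleftrightarrow> cops_win_within G k T"
    using cops_win_image_graph1(2)[OF inj wf] cops_win_image_graph1(2)[OF inj' wf'] inverse by metis
qed

lemma cop_number_image_graph:
  assumes "inj_on f (pverts G)" "parcs G \<subseteq> pverts G \<times> pverts G"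
  shows "cop_number (image_graph f G) = cop_number G"
  by (simp add: cop_number_def cops_win_image_graph[OF assms])

lemma capture_time_image_graph:
  assumes "inj_on f (pverts G)" "parcs G \<subseteq> pverts G \<times> pverts G"
  shows "capture_time (image_graph f G) = capture_time G"
  by (simp add: capture_time_def cop_number_image_graph[OF assms] cops_win_image_graph[OF assms])

lemma pair_graph_image_graph:
  assumes inj: "inj_on f (pverts G)" and G: "pair_graph G"
  shows "pair_graph (image_graph f G)"
proof -
  interpret pair_graph G by fact
  have s: "(x, y) \<in> parcs G \<Longrightarrow> (y, x) \<in> parcs G" for x y
    using pair_sym_arcs by (auto simp: symmetric_def sym_def)
  have inj': "f x = f y \<longleftrightarrow> x = y" if "x \<in> pverts G" "y \<in> pverts G" for x y
    using that inj by (auto dest: inj_onD)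
  show ?thesis
  proof
    show "symmetric (with_proj (image_graph f G))"
      using s by (force simp: symmetric_def sym_def image_graph_def arcs_ends_def arc_to_ends_def with_proj_def)
    fix e assume "e \<in> parcs (image_graph f G)"
    then obtain x y where "(x, y) \<in> parcs G" "e = (f x, f y)" by (auto simp: image_graph_def)
    moreover from this have "x \<in> pverts G" "y \<in> pverts G" "x \<noteq> y"
      using in_arcsD1 in_arcsD2 pair_no_loops[of "(x, y)"] by auto
    ultimately show "fst e \<in> pverts (image_graph f G)" "snd e \<in> pverts (image_graph f G)" "fst e \<noteq> snd e"
      by (auto simp: image_graph_def inj')
  qed (auto simp: image_graph_def)
qed

section \<open>Graphs with guarded exits\<close>

text \<open>
  Esc d g l is an exit guarded by the clause d.  The copies l = 0, ..., k are there because a cop may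
  stand on an exit itself.  Those with g = Some b are joined to the spots of side b only, so that a cop
  threatening one side and then stepping onto its spots does not guard the exits of the other.  Those
  with g = None are joined to no spot: they are starting vertices for the robber in case the cops'
  initial placement is bad.
\<close>

datatype ('a, 'd) vert =
  Tr 'a | Esc 'd "bool option" nat | Safe 'd "bool option" nat | Spot bool nat | Ctr

instance vert :: (countable, countable) countable
  by countable_datatype

text \<open>The cops' part of the graph in the abstract: \<open>sat d x\<close> says that
  \<open>x\<close> guards the exits of \<open>d\<close>. No edge of \<open>E\<close> leaves a track,
  and by \<open>track_clause\<close> every track needs a cop. Both threats lie on one track, so that
  a single cop per track cannot make them at the same time.\<close>

locale escape_graph =
  fixes k :: nat and X :: "'a set" and E :: "'a rel" and CL :: "'d set"
    and sat :: "'d \<Rightarrow> 'a \<Rightarrow> bool" and thr :: "bool \<Rightarrow> 'a" and trk :: "'a \<Rightarrow> nat" and sz :: "bool \<Rightarrow> nat"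
  assumes finite_X: "finite X" and finite_CL: "finite CL"
    and E_X: "(x, y) \<in> E \<Longrightarrow> x \<in> X \<and> y \<in> X"
    and E_sym: "(x, y) \<in> E \<Longrightarrow> (y, x) \<in> E"
    and E_irrefl: "(x, x) \<notin> E"
    and E_trk: "(x, y) \<in> E \<Longrightarrow> trk x = trk y"
    and trk_less: "x \<in> X \<Longrightarrow> trk x < k"
    and track_clause: "j < k \<Longrightarrow> \<exists>d\<in>CL. \<forall>x\<in>X. sat d x \<longleftrightarrow> trk x = j"
    and thr_X: "thr b \<in> X"
    and thr_trk: "trk (thr b) = trk (thr True)"
    and thr_neq: "thr True \<noteq> thr False"
begin

fun link :: "('a, 'd) vert \<Rightarrow> ('a, 'd) vert \<Rightarrow> bool" where
  "link (Tr x) (Tr y) \<longleftrightarrow> (x, y) \<in> E"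
| "link (Tr x) (Esc d g l) \<longleftrightarrow> sat d x"
| "link (Esc d g l) (Safe d' g' l') \<longleftrightarrow> d = d' \<and> g = g' \<and> l = l'"
| "link (Spot b i) (Esc d g l) \<longleftrightarrow> g = Some b"
| "link (Spot b i) (Tr x) \<longleftrightarrow> x = thr b"
| "link (Spot b i) (Spot b' i') \<longleftrightarrow> b \<noteq> b'"
| "link Ctr (Tr x) \<longleftrightarrow> True"
| "link _ _ \<longleftrightarrow> False"

definition adj :: "('a, 'd) vert \<Rightarrow> ('a, 'd) vert \<Rightarrow> bool" where
  "adj u v \<longleftrightarrow> link u v \<or> link v u"

definition V :: "('a, 'd) vert set" where
  "V = Tr ` X \<union> (\<lambda>(d, g, l). Esc d g l) ` (CL \<times> UNIV \<times> {..k}) \<union>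
    (\<lambda>(d, g, l). Safe d g l) ` (CL \<times> UNIV \<times> {..k}) \<union> (\<Union>b. Spot b ` {..<sz b}) \<union> {Ctr}"

definition G :: "('a, 'd) vert pair_pre_digraph" where
  "G = \<lparr>pverts = V, parcs = {(u, v). u \<in> V \<and> v \<in> V \<and> adj u v}\<rparr>"

lemma pverts_G [simp]: "pverts G = V"
  by (simp add: G_def)

lemma arc_iff [simp]: "(u, v) \<in> parcs G \<longleftrightarrow> u \<in> V \<and> v \<in> V \<and> adj u v"
  by (simp add: G_def)

lemma V_simps [simp]:
  "Tr x \<in> V \<longleftrightarrow> x \<in> X" "Esc d g l \<in> V \<longleftrightarrow> d \<in> CL \<and> l \<le> k" "Safe d g l \<in> V \<longleftrightarrow> d \<in> CL \<and> l \<le> k"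
  "Spot b i \<in> V \<longleftrightarrow> i < sz b" "Ctr \<in> V"
  by (auto simp: V_def image_iff)

lemma adj_sym: "adj u v \<Longrightarrow> adj v u"
  by (auto simp: adj_def)

lemma adj_irrefl: "\<not> adj u u"
  by (cases u) (auto simp: adj_def E_irrefl)

lemma adj_Tr [simp]:
  "adj (Tr x) (Tr y) \<longleftrightarrow> (x, y) \<in> E" "adj (Tr x) (Esc d g l) \<longleftrightarrow> sat d x"
  "adj (Tr x) (Spot b i) \<longleftrightarrow> x = thr b" "adj (Tr x) Ctr" "\<not> adj (Tr x) (Safe d g l)"
  "adj (Esc d g l) (Tr x) \<longleftrightarrow> sat d x"
  "adj (Spot b i) (Tr x) \<longleftrightarrow> x = thr b" "adj Ctr (Tr x)" "\<not> adj (Safe d g l) (Tr x)"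
  by (auto simp: adj_def E_sym)

lemma adj_Spot [simp]:
  "adj (Spot b i) (Spot b' i') \<longleftrightarrow> b \<noteq> b'" "adj (Spot b i) (Esc d g l) \<longleftrightarrow> g = Some b"
  "adj (Esc d g l) (Spot b i) \<longleftrightarrow> g = Some b"
  "\<not> adj (Spot b i) Ctr" "\<not> adj (Spot b i) (Safe d g l)" "\<not> adj Ctr (Spot b i)" "\<not> adj (Safe d g l) (Spot b i)"
  by (auto simp: adj_def)

lemma adj_Esc [simp]:
  "adj (Esc d g l) (Safe d' g' l') \<longleftrightarrow> d = d' \<and> g = g' \<and> l = l'"
  "adj (Safe d' g' l') (Esc d g l) \<longleftrightarrow> d = d' \<and> g = g' \<and> l = l'"
  "\<not> adj (Esc d g l) (Esc d' g' l')" "\<not> adj (Safe d g l) (Safe d' g' l')"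
  "\<not> adj (Esc d g l) Ctr" "\<not> adj Ctr (Esc d g l)" "\<not> adj (Safe d g l) Ctr" "\<not> adj Ctr (Safe d g l)"
  by (auto simp: adj_def)

lemma finite_V: "finite V"
  using finite_X finite_CL by (auto simp: V_def)

lemma card_V: "card V = card X + 6 * (k + 1) * card CL + sz True + sz False + 1"
proof -
  let ?S = "CL \<times> (UNIV :: bool option set) \<times> {..k}"
  let ?e = "\<lambda>(d, g, l). Esc d g l :: ('a, 'd) vert" and ?f = "\<lambda>(d, g, l). Safe d g l :: ('a, 'd) vert"
  have V: "V = Tr ` X \<union> (?e ` ?S \<union> (?f ` ?S \<union> (Spot True ` {..<sz True} \<union>
      (Spot False ` {..<sz False} \<union> {Ctr}))))"
    by (auto simp: V_def UNIV_bool)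
  have fin: "finite ?S" "finite X" using finite_CL finite_X by auto
  have 1: "card (Tr ` X :: ('a, 'd) vert set) = card X" by (simp add: card_image inj_on_def)
  have "(UNIV :: bool option set) = {None, Some True, Some False}"
    by (auto simp: UNIV_option_conv UNIV_bool)
  then have "card (UNIV :: bool option set) = card {None, Some True, Some False}"
    by (rule arg_cong)
  then have "card (UNIV :: bool option set) = 3" by simp
  then have "card ?S = 3 * (k + 1) * card CL"
    by (simp add: card_cartesian_product)
  then have 2: "card (?e ` ?S) = 3 * (k + 1) * card CL" "card (?f ` ?S) = 3 * (k + 1) * card CL"
    by (auto simp: card_image inj_on_def)
  have 3: "card (Spot b ` {..<sz b} :: ('a, 'd) vert set) = sz b" for b
    by (simp add: card_image inj_on_def)
  show ?thesis
    unfolding V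
    apply (subst card_Un_disjoint, use fin in \<open>(auto; fail)+\<close>)+
    using 1 2 3[of True] 3[of False] by (simp add: algebra_simps)
qed

lemma pair_graph_G: "pair_graph G"
proof
  have "parcs G \<subseteq> V \<times> V" by (auto simp: G_def)
  then show "finite (parcs G)" using finite_V by (meson finite_SigmaI finite_subset)
  show "symmetric (with_proj G)"
    by (force simp: symmetric_def sym_def arcs_ends_def arc_to_ends_def with_proj_def G_def adj_sym)
qed (use finite_V adj_irrefl in \<open>auto simp: G_def\<close>)

lemma finite_arcs: "finite (parcs G)"
proof -
  interpret pair_graph G by (rule pair_graph_G)
  show ?thesis by simp
qed

section \<open>Escape through an unguarded exit\<close>

text \<open>On the exit, the robber is out of reach for one turn, as is the pendant vertex behind
  it; on the pendant vertex, its only edge is already burned.\<close>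

definition escaped :: "nat \<Rightarrow> (nat \<Rightarrow> ('a, 'd) vert) \<Rightarrow> ('a, 'd) vert \<Rightarrow> ('a, 'd) vert rel \<Rightarrow> bool" where
  "escaped n P r B \<longleftrightarrow> (\<exists>d\<in>CL. \<exists>g. \<exists>l\<le>k.
     (r = Esc d g l \<and> (Esc d g l, Safe d g l) \<notin> B \<and>
       (\<forall>i<n. P i \<noteq> Esc d g l \<and> P i \<noteq> Safe d g l \<and> \<not> adj (P i) (Esc d g l))) \<or>
     (r = Safe d g l \<and> (Esc d g l, Safe d g l) \<in> B \<and> (\<forall>i<n. P i \<noteq> Safe d g l)))"

lemma escaped_not_caught: "escaped n P r B \<Longrightarrow> \<not> caught n P r"
  by (auto simp: escaped_def caught_def)

lemma adj_Safe: "adj u (Safe d g l) \<Longrightarrow> u = Esc d g l"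
  by (cases u) auto

lemma escaped_step:
  assumes esc: "escaped n P r B" and mv: "cop_move (parcs G - B) n P P'"
  shows "\<not> caught n P' r \<and>
    (\<exists>r'. (r' = r \<or> (r, r') \<in> parcs G - B) \<and> escaped n P' r' (burn B r r'))"
proof -
  from esc obtain d g l where dl: "d \<in> CL" "l \<le> k" and
    cs: "(r = Esc d g l \<and> (Esc d g l, Safe d g l) \<notin> B \<and>
       (\<forall>i<n. P i \<noteq> Esc d g l \<and> P i \<noteq> Safe d g l \<and> \<not> adj (P i) (Esc d g l))) \<or>
     (r = Safe d g l \<and> (Esc d g l, Safe d g l) \<in> B \<and> (\<forall>i<n. P i \<noteq> Safe d g l))"
    unfolding escaped_def by blast
  from cs show ?thesis
  proof
    assume r: "r = Esc d g l \<and> (Esc d g l, Safe d g l) \<notin> B \<and>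
       (\<forall>i<n. P i \<noteq> Esc d g l \<and> P i \<noteq> Safe d g l \<and> \<not> adj (P i) (Esc d g l))"
    have away: "P' i \<noteq> Esc d g l \<and> P' i \<noteq> Safe d g l" if "i < n" for i
    proof -
      have "P' i = P i \<or> adj (P i) (P' i)" using mv that by (auto simp: cop_move_def)
      then show ?thesis using r that adj_Safe by metis
    qed
    have "escaped n P' (Safe d g l) (burn B r (Safe d g l))"
      unfolding escaped_def
      by (intro bexI[of _ d] exI[of _ g] exI[of _ l]) (use dl away r in \<open>auto simp: burn_def\<close>)
    moreover have "(r, Safe d g l) \<in> parcs G - B" using r dl by simp
    ultimately have "\<exists>r'. (r' = r \<or> (r, r') \<in> parcs G - B) \<and> escaped n P' r' (burn B r r')"
      by blast
    then show ?thesis using away r by (simp add: caught_def)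
  next
    assume r: "r = Safe d g l \<and> (Esc d g l, Safe d g l) \<in> B \<and> (\<forall>i<n. P i \<noteq> Safe d g l)"
    have away: "P' i \<noteq> Safe d g l" if "i < n" for i
    proof
      assume "P' i = Safe d g l"
      moreover have "P' i = P i \<or> (adj (P i) (P' i) \<and> (P i, P' i) \<notin> B)"
        using mv that by (auto simp: cop_move_def)
      ultimately show False using r that adj_Safe by metis
    qed
    have "escaped n P' r (burn B r r)"
      unfolding escaped_def
      by (intro bexI[of _ d] exI[of _ g] exI[of _ l]) (use dl away r in \<open>auto simp: burn_def\<close>)
    then show ?thesis using away r unfolding caught_def by blast
  qed
qed

lemma free_copy:
  fixes P :: "nat \<Rightarrow> ('a, 'd) vert"
  assumes "n \<le> k"
  shows "\<exists>l\<le>k. \<forall>i<n. P i \<noteq> Esc d g l \<and> P i \<noteq> Safe d g l"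
proof -
  define c where "c v = (case v of Esc d g l \<Rightarrow> l | Safe d g l \<Rightarrow> l | _ \<Rightarrow> 0)" for v :: "('a, 'd) vert"
  have "card ((\<lambda>i. c (P i)) ` {..<n}) < card {..k}"
    using card_image_le[of "{..<n}" "\<lambda>i. c (P i)"] assms by simp
  then have "\<not> {..k} \<subseteq> (\<lambda>i. c (P i)) ` {..<n}"
    using card_mono[of "(\<lambda>i. c (P i)) ` {..<n}" "{..k}"] by auto
  then obtain l where "l \<le> k" "\<forall>i<n. c (P i) \<noteq> l" by auto
  then show ?thesis by (force simp: c_def)
qed

lemma escape_start:
  assumes n: "n \<le> k" and d: "d \<in> CL" and PV: "\<forall>i<n. P i \<in> V"
    and unguarded: "\<forall>i<n. \<forall>x\<in>X. P i = Tr x \<longrightarrow> \<not> sat d x"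
  shows "\<exists>r\<in>V. escaped n P r {}"
proof -
  from free_copy[OF n] obtain l where l: "l \<le> k" "\<forall>i<n. P i \<noteq> Esc d None l \<and> P i \<noteq> Safe d None l"
    by blast
  have "\<not> adj (P i) (Esc d None l)" if "i < n" for i
    using that PV unguarded l by (cases "P i") auto
  then have "escaped n P (Esc d None l) {}"
    using l d by (auto simp: escaped_def)
  with l d show ?thesis by (intro bexI) auto
qed

text \<open>Fewer than \<open>k\<close> cops leave some track empty at the start, and the robber
  begins on an exit guarded by that track alone.\<close>

lemma not_cops_win_less:
  assumes "n < k"
  shows "\<not> cops_win G n"
proof
  assume "cops_win G n"
  then obtain S where S: "legal_strategy G n S"
    and win: "\<forall>R. robber_play G R \<longrightarrow> (\<exists>T. captured_within n S R T)"
    by (auto simp: cops_win_def)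
  let ?P = "S []"
  have PV: "\<forall>i<n. ?P i \<in> V" using S by (simp add: legal_strategy_def)
  define c where "c v = (case v of Tr x \<Rightarrow> trk x | _ \<Rightarrow> 0)" for v :: "('a, 'd) vert"
  have "card ((\<lambda>i. c (?P i)) ` {..<n}) < card {..<k}"
    using card_image_le[of "{..<n}" "\<lambda>i. c (?P i)"] assms by simp
  then have "\<not> {..<k} \<subseteq> (\<lambda>i. c (?P i)) ` {..<n}"
    using card_mono[of "(\<lambda>i. c (?P i)) ` {..<n}" "{..<k}"] by auto
  then obtain j where j: "j < k" "\<forall>i<n. c (?P i) \<noteq> j" by auto
  from track_clause[OF j(1)] obtain d where d: "d \<in> CL" "\<forall>x\<in>X. sat d x \<longleftrightarrow> trk x = j" by blast
  have start: "\<exists>r\<in>V. escaped n ?P r {}"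
    by (rule escape_start[OF _ d(1) PV]) (use assms d j in \<open>auto simp: c_def\<close>)
  have "\<exists>R. robber_play G R \<and> (\<forall>t. escaped n (cop_pos S R t) (R t) (burned R t))"
    by (rule evading_play[OF S, where Inv = "\<lambda>_. escaped n"]) (use start escaped_step in auto)
  then obtain R where R: "robber_play G R" "\<And>t. escaped n (cop_pos S R t) (R t) (burned R t)" by blast
  have "\<not> caught n (cop_pos S R t) (R t)" "\<not> caught n (cop_pos S R (Suc t)) (R t)" for t
    using escaped_not_caught[OF R(2)] escaped_step[OF R(2)] S R(1)
    by (auto simp: legal_strategy_cop_move)
  then have "\<not> captured_within n S R T" for T
    by (auto simp: captured_within_def caught_def)
  with win R(1) show False by blast
qed

section \<open>One cop on each track\<close>

definition valid :: "(nat \<Rightarrow> 'a) \<Rightarrow> bool" where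
  "valid Q \<longleftrightarrow> (\<forall>j<k. Q j \<in> X \<and> trk (Q j) = j) \<and> (\<forall>d\<in>CL. \<exists>j<k. sat d (Q j))"

definition step :: "(nat \<Rightarrow> 'a) \<Rightarrow> (nat \<Rightarrow> 'a) \<Rightarrow> bool" where
  "step Q Q' \<longleftrightarrow> valid Q \<and> valid Q' \<and> (\<forall>j<k. Q' j = Q j \<or> (Q j, Q' j) \<in> E)"

lemma step_sym: "step Q Q' \<Longrightarrow> step Q' Q"
  unfolding step_def using E_sym by metis

definition guarded :: "(nat \<Rightarrow> ('a, 'd) vert) \<Rightarrow> bool" where
  "guarded P \<longleftrightarrow> (\<forall>d\<in>CL. \<exists>i<k. \<exists>x\<in>X. P i = Tr x \<and> sat d x)"

text \<open>Indexing positions by track instead of by cop removes the permutation of the cops from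
  the rest of the argument.\<close>

definition occ :: "(nat \<Rightarrow> ('a, 'd) vert) \<Rightarrow> nat \<Rightarrow> 'a" where
  "occ P j = (THE x. x \<in> X \<and> trk x = j \<and> (\<exists>i<k. P i = Tr x))"

text \<open>Each of the \<open>k\<close> tracks has a clause that only a cop on it can satisfy, so
  assigning to a track such a cop is an injection among \<open>k\<close> cops, hence a bijection. In
  particular no cop is outside the tracks.\<close>

lemma guarded_perm:
  assumes "guarded P"
  shows "\<exists>\<sigma> Q. bij_betw \<sigma> {..<k} {..<k} \<and> (\<forall>j<k. P (\<sigma> j) = Tr (Q j) \<and> Q j \<in> X \<and> trk (Q j) = j)"
proof -
  have "\<exists>i x. i < k \<and> P i = Tr x \<and> x \<in> X \<and> trk x = j" if j: "j < k" for j
  proof -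
    from track_clause[OF j] obtain d where d: "d \<in> CL" "\<forall>x\<in>X. sat d x \<longleftrightarrow> trk x = j" by blast
    with assms show ?thesis unfolding guarded_def by blast
  qed
  then have "\<exists>\<sigma> Q. \<forall>j<k. \<sigma> j < k \<and> P (\<sigma> j) = Tr (Q j) \<and> Q j \<in> X \<and> trk (Q j) = j"
    by metis
  then obtain \<sigma> Q where *: "\<And>j. j < k \<Longrightarrow> \<sigma> j < k \<and> P (\<sigma> j) = Tr (Q j) \<and> Q j \<in> X \<and> trk (Q j) = j"
    by blast
  have "inj_on \<sigma> {..<k}"
    by (rule inj_onI) (metis * lessThan_iff vert.inject(1))
  moreover have "\<sigma> ` {..<k} \<subseteq> {..<k}" using * by auto
  ultimately have "bij_betw \<sigma> {..<k} {..<k}"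
    by (metis bij_betw_def endo_inj_surj finite_lessThan)
  with * show ?thesis by blast
qed

lemma guarded_occ:
  assumes "guarded P"
  shows "i < k \<Longrightarrow> \<exists>x\<in>X. P i = Tr x \<and> occ P (trk x) = x"
    and "valid (occ P)" and "j < k \<Longrightarrow> \<exists>i<k. P i = Tr (occ P j)"
proof -
  from guarded_perm[OF assms] obtain \<sigma> Q where \<sigma>: "bij_betw \<sigma> {..<k} {..<k}"
    "\<And>j. j < k \<Longrightarrow> P (\<sigma> j) = Tr (Q j)" "\<And>j. j < k \<Longrightarrow> Q j \<in> X \<and> trk (Q j) = j" by blast
  have P: "\<exists>j<k. i = \<sigma> j \<and> P i = Tr (Q j)" if "i < k" for i
  proof -
    have "i \<in> \<sigma> ` {..<k}" using \<sigma>(1) that by (simp add: bij_betw_def)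
    with \<sigma>(2) show ?thesis by auto
  qed
  have \<sigma>k: "\<sigma> j < k" if "j < k" for j
    using bij_betwE[OF \<sigma>(1)] that by auto
  have occ: "occ P j = Q j" if "j < k" for j
    unfolding occ_def
  proof (rule the_equality)
    show "Q j \<in> X \<and> trk (Q j) = j \<and> (\<exists>i<k. P i = Tr (Q j))"
      using that \<sigma> \<sigma>k by blast
    fix x assume "x \<in> X \<and> trk x = j \<and> (\<exists>i<k. P i = Tr x)"
    then show "x = Q j" using P \<sigma>(3) by fastforce
  qed
  show "i < k \<Longrightarrow> \<exists>x\<in>X. P i = Tr x \<and> occ P (trk x) = x" using P[of i] \<sigma>(3) occ by force
  show "j < k \<Longrightarrow> \<exists>i<k. P i = Tr (occ P j)" using occ \<sigma>(2) \<sigma>k by metis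
  show "valid (occ P)"
    unfolding valid_def
  proof (intro conjI allI impI ballI)
    fix d assume "d \<in> CL"
    with assms obtain i x where "i < k" "x \<in> X" "P i = Tr x" "sat d x"
      unfolding guarded_def by blast
    with P[of i] occ show "\<exists>j<k. sat d (occ P j)" by fastforce
  qed (use \<sigma>(3) occ in auto)
qed

text \<open>A cop who goes from one track vertex to another in one move uses an edge of
  \<open>E\<close> and stays on his track, so the permutation of the cops never changes.\<close>

lemma guarded_step:
  assumes P: "guarded P" and P': "guarded P'" and mv: "cop_move (parcs G - B) k P P'"
  shows "step (occ P) (occ P')"
  unfolding step_def
proof (intro conjI allI impI guarded_occ(2) P P')
  fix j assume j: "j < k"
  from guarded_occ(3)[OF P j] obtain i where i: "i < k" "P i = Tr (occ P j)" by blast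
  from guarded_occ(1)[OF P' i(1)] obtain y where y: "y \<in> X" "P' i = Tr y" "occ P' (trk y) = y" by blast
  have tj: "trk (occ P j) = j" using guarded_occ(2)[OF P] j by (simp add: valid_def)
  have "P' i = P i \<or> (P i, P' i) \<in> parcs G" using mv i(1) by (auto simp: cop_move_def)
  then have "y = occ P j \<or> (occ P j, y) \<in> E" using i(2) y(2) by auto
  then show "occ P' j = occ P j \<or> (occ P j, occ P' j) \<in> E"
    using y(3) tj E_trk by metis
qed

end

text \<open>
  The n-th double step of the trail goes from A-spot n mod s to the B-spot with difference
  2 (n div s) + 1 and on to A-spot n + 1, at difference 2 (n div s).
\<close>

definition trail :: "nat \<Rightarrow> nat \<Rightarrow> nat" where
  "trail s t = (if even t then (t div 2) mod s else (t div 2 + 2 * (t div 2 div s) + 1) mod s)"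

definition trail_index :: "nat \<Rightarrow> nat \<Rightarrow> nat \<Rightarrow> nat" where
  "trail_index s a b = (let d = (b + s - a) mod s in
     if odd d then 2 * (d div 2 * s + a) else 2 * (d div 2 * s + (a + s - 1) mod s) + 1)"

text \<open>The edges of the trail are distinct because an edge determines its index: the difference
  of its ends gives the lap and the parity of \<open>t\<close>, and its A-spot then gives the place
  within the lap.\<close>

lemma trail_index_trail:
  assumes s: "0 < s" and t: "t < 2 * (s * (s div 2))"
  defines "a \<equiv> (if even t then trail s t else trail s (Suc t))"
    and "b \<equiv> (if even t then trail s (Suc t) else trail s t)"
  shows "trail_index s a b = t"
proof -
  define d where "d = (b + s - a) mod s"
  define n where "n = t div 2"
  define u where "u = n div s"
  have n: "n = u * s + n mod s" by (simp add: u_def)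
  have "n < s * (s div 2)" using t by (simp add: n_def)
  \<comment> \<open>With only \<open>s div 2\<close> laps the differences \<open>2 * u\<close> and
    \<open>2 * u + 1\<close> stay below \<open>s\<close>, so that they are not identified modulo
    \<open>s\<close>.\<close>
  then have u: "2 * u + 1 < s"
    using less_mult_imp_div_less[of n "s div 2" s] by (simp add: u_def mult.commute)
  have as: "a < s" using s by (auto simp: a_def trail_def)
  have "int d = (int b - int a + int s) mod int s"
    using as by (simp add: d_def zmod_int of_nat_diff algebra_simps)
  then have D: "[int d = int b - int a] (mod int s)" by (simp add: cong_def)
  show ?thesis
  proof (cases "even t")
    case True
    then have a: "a = n mod s" and b: "b = (n + 2 * u + 1) mod s" and tn: "t = 2 * n"
      by (auto simp: a_def b_def trail_def n_def u_def)
    note D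
    also have "[int b - int a = (int n + 2 * int u + 1) - int n] (mod int s)"
      unfolding a b zmod_int by (intro cong_diff) (auto simp: cong_def algebra_simps)
    finally have "[int d = int (2 * u + 1)] (mod int s)" by (simp add: add.commute)
    then have "[d = 2 * u + 1] (mod s)" by (simp only: cong_int_iff)
    then have "d = 2 * u + 1" using u s by (simp add: cong_def d_def)
    then show ?thesis using a tn n unfolding trail_index_def d_def[symmetric] by simp
  next
    case False
    then have tn: "t = 2 * n + 1" by (simp add: n_def)
    have a: "a = (n + 1) mod s" and b: "b = (n + 2 * u + 1) mod s"
      by (simp_all add: a_def b_def trail_def u_def tn)
    note D
    also have "[int b - int a = (int n + 2 * int u + 1) - (int n + 1)] (mod int s)"
      unfolding a b zmod_int by (intro cong_diff) (auto simp: cong_def algebra_simps)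
    finally have "[int d = int (2 * u)] (mod int s)" by simp
    then have "[d = 2 * u] (mod s)" by (simp only: cong_int_iff)
    then have d: "d = 2 * u" using u s by (simp add: cong_def d_def)
    \<comment> \<open>An edge of odd index ends at the A-spot of \<open>n + 1\<close>, so one has to
      be taken off cyclically.\<close>
    have "(a + s - 1) mod s = (n + 1 + (s - 1)) mod s"
      unfolding a using s by (metis Nat.add_diff_assoc One_nat_def Suc_leI mod_add_left_eq)
    also have "\<dots> = n mod s" using s by simp
    finally show ?thesis using d tn n unfolding trail_index_def d_def[symmetric] by simp
  qed
qed

section \<open>The robber's survival time\<close>

locale counter_game = escape_graph k X E CL sat thr trk sz
  for k :: nat and X :: "'a set" and E CL and sat :: "'d \<Rightarrow> 'a \<Rightarrow> bool" and thr trk sz +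
  fixes rk :: "(nat \<Rightarrow> 'a) \<Rightarrow> nat" and L s :: nat
  assumes rk_step: "step Q Q' \<Longrightarrow> rk Q' \<le> Suc (rk Q)"
    and rk_le: "rk Q \<le> L"
    and rk_thr: "valid Q \<Longrightarrow> Q (trk (thr b)) = thr b \<Longrightarrow> rk Q = (if b then L else 0)"
    and L_pos: "0 < L"
    and s_pos: "0 < s" and s_sz: "s \<le> sz b"
begin

definition spot :: "nat \<Rightarrow> ('a, 'd) vert" where
  "spot \<tau> = Spot (even \<tau>) (trail s \<tau>)"

definition len :: nat where
  "len = 2 * (s * (s div 2))"

lemma spot_V: "spot \<tau> \<in> V"
proof -
  have "trail s \<tau> < s" using s_pos by (simp add: trail_def)
  then show ?thesis using s_sz[of "even \<tau>"] by (simp add: spot_def)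
qed

definition trail_arcs :: "nat \<Rightarrow> ('a, 'd) vert rel" where
  "trail_arcs \<tau> = (\<Union>i<\<tau>. {(spot i, spot (Suc i)), (spot (Suc i), spot i)})"

lemma trail_arcs_Suc:
  "trail_arcs (Suc \<tau>) = trail_arcs \<tau> \<union> {(spot \<tau>, spot (Suc \<tau>)), (spot (Suc \<tau>), spot \<tau>)}"
  unfolding trail_arcs_def lessThan_Suc by auto

lemma spot_edge_inj:
  assumes i: "i < len" and j: "j < len"
    and eq: "{spot i, spot (Suc i)} = {spot j, spot (Suc j)}"
  shows "i = j"
proof -
  let ?a = "\<lambda>t. if even t then trail s t else trail s (Suc t)"
  let ?b = "\<lambda>t. if even t then trail s (Suc t) else trail s t"
  have set: "{spot t, spot (Suc t)} = {Spot True (?a t), Spot False (?b t)}" for t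
    by (auto simp: spot_def)
  have "?a i = ?a j" "?b i = ?b j"
    using eq unfolding set by (auto simp only: doubleton_eq_iff vert.inject)
  then show ?thesis
    using trail_index_trail[OF s_pos i[unfolded len_def]]
      trail_index_trail[OF s_pos j[unfolded len_def]] by simp
qed

lemma next_spot_fresh:
  assumes "\<tau> < len"
  shows "(spot \<tau>, spot (Suc \<tau>)) \<notin> trail_arcs \<tau>"
proof
  assume "(spot \<tau>, spot (Suc \<tau>)) \<in> trail_arcs \<tau>"
  then obtain i where "i < \<tau>"
    "(spot \<tau>, spot (Suc \<tau>)) = (spot i, spot (Suc i)) \<or> (spot \<tau>, spot (Suc \<tau>)) = (spot (Suc i), spot i)"
    by (auto simp: trail_arcs_def)
  then have "i < \<tau>" "{spot i, spot (Suc i)} = {spot \<tau>, spot (Suc \<tau>)}" by auto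
  with spot_edge_inj[of i \<tau>] assms show False by simp
qed

text \<open>
  The robber has used \<tau> - \<tau>0 edges of the trail.  Between two of them the rank has to run through
  all of [0, L], and the last summand is what has been run through since the last one.
\<close>

definition sitting :: "nat \<Rightarrow> nat \<Rightarrow> (nat \<Rightarrow> ('a, 'd) vert) \<Rightarrow> ('a, 'd) vert \<Rightarrow> ('a, 'd) vert rel \<Rightarrow> bool" where
  "sitting \<tau>0 t P r B \<longleftrightarrow> (\<exists>\<tau>\<ge>\<tau>0. guarded P \<and> r = spot \<tau> \<and> occ P (trk (thr (even \<tau>))) \<noteq> thr (even \<tau>) \<and>
     B \<inter> parcs G \<subseteq> trail_arcs \<tau> \<and>
     (\<tau> - \<tau>0) * L + (if even \<tau> then rk (occ P) else L - rk (occ P)) \<le> t + L)"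

lemma guarded_not_thr:
  assumes "guarded P" "i < k" "occ P (trk (thr b)) \<noteq> thr b"
  shows "P i \<noteq> Tr (thr b)"
  using guarded_occ(1)[OF assms(1,2)] assms(3) by auto

lemma sitting_not_caught: "sitting \<tau>0 t P r B \<Longrightarrow> \<not> caught k P r"
proof
  assume "sitting \<tau>0 t P r B" "caught k P r"
  then obtain i \<tau> where "guarded P" "i < k" "P i = spot \<tau>"
    by (auto simp: sitting_def caught_def)
  then show False using guarded_occ(1)[of P i] by (auto simp: spot_def)
qed

lemma sitting_step:
  assumes sit: "sitting \<tau>0 t P r B" and t: "t < (len - 2) * L" and \<tau>0: "\<tau>0 \<le> 1"
    and mv: "cop_move (parcs G - B) k P P'"
  shows "\<not> caught k P' r \<and> (\<exists>r'. (r' = r \<or> (r, r') \<in> parcs G - B) \<and>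
    (escaped k P' r' (burn B r r') \<or> sitting \<tau>0 (Suc t) P' r' (burn B r r')))"
proof -
  from sit obtain \<tau> where \<tau>: "\<tau>0 \<le> \<tau>" and P: "guarded P" and r: "r = spot \<tau>"
    and nthr: "occ P (trk (thr (even \<tau>))) \<noteq> thr (even \<tau>)" and B: "B \<inter> parcs G \<subseteq> trail_arcs \<tau>"
    and bound: "(\<tau> - \<tau>0) * L + (if even \<tau> then rk (occ P) else L - rk (occ P)) \<le> t + L"
    unfolding sitting_def by blast
  let ?b = "even \<tau>"
  have Pi: "\<exists>x\<in>X. P i = Tr x \<and> x \<noteq> thr ?b" if "i < k" for i
    using guarded_occ(1)[OF P that] guarded_not_thr[OF P that nthr] by blast
  have P'i: "P' i \<in> V" "\<forall>j. P' i \<noteq> Spot ?b j" if "i < k" for i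
  proof -
    have "P' i = P i \<or> (P i, P' i) \<in> parcs G" using mv that by (auto simp: cop_move_def)
    with Pi[OF that] show "P' i \<in> V" "\<forall>j. P' i \<noteq> Spot ?b j" by auto
  qed
  have nc: "\<not> caught k P' r"
    using P'i(2) by (auto simp: caught_def r spot_def)
  have "\<exists>r'. (r' = r \<or> (r, r') \<in> parcs G - B) \<and>
    (escaped k P' r' (burn B r r') \<or> sitting \<tau>0 (Suc t) P' r' (burn B r r'))"
  proof (cases "guarded P'")
    case False
    then obtain d where d: "d \<in> CL" "\<forall>i<k. \<forall>x\<in>X. P' i = Tr x \<longrightarrow> \<not> sat d x"
      by (auto simp: guarded_def)
    from free_copy[OF order_refl] obtain l where l: "l \<le> k"
      "\<forall>i<k. P' i \<noteq> Esc d (Some ?b) l \<and> P' i \<noteq> Safe d (Some ?b) l" by blast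
    let ?e = "Esc d (Some ?b) l"
    \<comment> \<open>No cop was at \<open>thr ?b\<close>, hence none is now on a spot of the
      robber's side. A cop coming from the other threat may be on a spot of the other side, which is
      not joined to exits with \<open>Some ?b\<close>.\<close>
    have "\<not> adj (P' i) ?e" if "i < k" for i
      using P'i[OF that] d(2) l(2) that by (cases "P' i") auto
    moreover have arcs: "(u, v) \<in> trail_arcs \<tau> \<Longrightarrow> \<exists>b i. v = Spot b i" for u v
      by (auto simp: trail_arcs_def spot_def)
    have *: "(u, v) \<notin> B" if "u \<in> V" "v \<in> V" "adj u v" "\<forall>b i. v \<noteq> Spot b i" for u v
    proof
      assume "(u, v) \<in> B"
      with B that have "(u, v) \<in> trail_arcs \<tau>" by auto
      with arcs that(4) show False by metis
    qed
    ultimately have "escaped k P' ?e (burn B r ?e)"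
      unfolding escaped_def
      by (intro bexI[of _ d] exI[of _ "Some ?b"] exI[of _ l])
        (use d l in \<open>auto simp: burn_def r spot_def\<close>)
    moreover have "(r, ?e) \<in> parcs G - B"
      using * spot_V[of \<tau>] d(1) l(1) by (simp add: r spot_def)
    ultimately show ?thesis by blast
  next
    case True
    have st: "step (occ P) (occ P')" by (rule guarded_step[OF P True mv])
    note rk1 = rk_step[OF st] rk_step[OF step_sym[OF st]] rk_le[of "occ P"] rk_le[of "occ P'"]
    have bound': "(\<tau> - \<tau>0) * L + (if even \<tau> then rk (occ P') else L - rk (occ P')) \<le> Suc t + L"
      using bound rk1 by (auto split: if_splits)
    show ?thesis
    proof (cases "occ P' (trk (thr ?b)) = thr ?b")
      case False
      have "burn B r r \<inter> parcs G \<subseteq> trail_arcs \<tau>"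
        using B adj_irrefl by (auto simp: burn_def)
      then have "sitting \<tau>0 (Suc t) P' r (burn B r r)"
        unfolding sitting_def using \<tau> True False r bound' by blast
      then show ?thesis by blast
    next
      case thr: True
      have rk': "rk (occ P') = (if ?b then L else 0)"
        using rk_thr[OF guarded_occ(2)[OF True] thr] by auto
      with bound' have time: "(\<tau> - \<tau>0) * L \<le> Suc t" by (auto split: if_splits)
      also have "\<dots> \<le> (len - 2) * L" using t by simp
      finally have "\<tau> - \<tau>0 \<le> len - 2" using L_pos by simp
      moreover have "2 < len" using t by (cases "2 < len") auto
      \<comment> \<open>The 2 in \<open>len - 2\<close>: one for the possible start at
        \<open>\<tau>0 = 1\<close>, one because the edge about to be used has index
        \<open>\<tau>\<close> and must still belong to the trail.\<close>
      ultimately have "\<tau> < len" using \<tau>0 by linarith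
      let ?r = "spot (Suc \<tau>)"
      have arc: "(r, ?r) \<in> parcs G" using spot_V[of \<tau>] spot_V[of "Suc \<tau>"] by (simp add: r spot_def)
      then have "(r, ?r) \<in> parcs G - B"
        using next_spot_fresh[OF \<open>\<tau> < len\<close>] B r by blast
      moreover have "sitting \<tau>0 (Suc t) P' ?r (burn B r ?r)"
        unfolding sitting_def
      proof (intro exI[of _ "Suc \<tau>"] conjI)
        show "burn B r ?r \<inter> parcs G \<subseteq> trail_arcs (Suc \<tau>)"
          using B adj_sym unfolding trail_arcs_Suc by (auto simp: burn_def r)
        have "thr (even (Suc \<tau>)) \<noteq> thr ?b" using thr_neq by (cases ?b) auto
        then show "occ P' (trk (thr (even (Suc \<tau>)))) \<noteq> thr (even (Suc \<tau>))"
          using thr thr_trk by metis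
        show "(Suc \<tau> - \<tau>0) * L + (if even (Suc \<tau>) then rk (occ P') else L - rk (occ P')) \<le> Suc t + L"
          using time \<tau> by (simp add: Suc_diff_le rk')
      qed (use \<tau> True in auto)
      ultimately show ?thesis by blast
    qed
  qed
  with nc show ?thesis by blast
qed

lemma not_cops_win_within:
  assumes T: "T \<le> (len - 2) * L"
  shows "\<not> cops_win_within G k T"
proof
  assume "cops_win_within G k T"
  then obtain S where S: "legal_strategy G k S" and win: "\<forall>R. robber_play G R \<longrightarrow> captured_within k S R T"
    by (auto simp: cops_win_within_def)
  let ?P = "S []"
  have PV: "\<forall>i<k. ?P i \<in> V" using S by (simp add: legal_strategy_def)
  \<comment> \<open>The initial placement may already threaten side \<open>True\<close>; then the
    trail is entered at its second spot, on the other side.\<close>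
  define \<tau>0 :: nat where "\<tau>0 = (if occ ?P (trk (thr True)) = thr True then 1 else 0)"
  define Inv where "Inv t P r B \<longleftrightarrow> escaped k P r B \<or> sitting \<tau>0 t P r B" for t P r B
  have "\<exists>r\<in>V. Inv 0 ?P r {}"
  proof (cases "guarded ?P")
    case True
    have "occ ?P (trk (thr (even \<tau>0))) \<noteq> thr (even \<tau>0)"
      using thr_neq thr_trk[of False] by (auto simp: \<tau>0_def)
    \<comment> \<open>The initial rank is arbitrary; the summand \<open>L\<close> on the right of
      the bound in \<open>sitting\<close> pays for it.\<close>
    then have "sitting \<tau>0 0 ?P (spot \<tau>0) {}"
      unfolding sitting_def using True rk_le by (intro exI[of _ \<tau>0]) auto
    then show ?thesis using spot_V by (auto simp: Inv_def)
  next
    case False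
    then obtain d where "d \<in> CL" "\<forall>i<k. \<forall>x\<in>X. ?P i = Tr x \<longrightarrow> \<not> sat d x"
      by (auto simp: guarded_def)
    from escape_start[OF order_refl this(1) PV this(2)] show ?thesis by (auto simp: Inv_def)
  qed
  then have start: "\<exists>r\<in>pverts G. Inv 0 ?P r {}" by simp
  have "\<exists>R. robber_play G R \<and> \<not> captured_within k S R T"
  proof (rule evasion[OF S, where Inv = Inv])
    show "\<exists>r\<in>pverts G. Inv 0 ?P r {}" by (rule start)
  next
    fix t P r B P'
    assume "Inv t P r B" and t: "t < T" and mv: "cop_move (parcs G - B) k P P'"
    moreover have "t < (len - 2) * L" "\<tau>0 \<le> 1" using t T by (auto simp: \<tau>0_def)
    ultimately show "\<not> caught k P' r \<and>
        (\<exists>r'. (r' = r \<or> (r, r') \<in> parcs G - B) \<and> Inv (Suc t) P' r' (burn B r r'))"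
      unfolding Inv_def using escaped_step[OF _ mv, of r] sitting_step[OF _ _ _ mv, of \<tau>0 t r] by blast
  next
    show "Inv t P r B \<Longrightarrow> \<not> caught k P r" for t P r B
      using escaped_not_caught sitting_not_caught by (auto simp: Inv_def)
  qed
  with win show False by blast
qed

end

section \<open>Capture by k cops\<close>

context escape_graph
begin

definition spot_arcs :: "('a, 'd) vert rel" where
  "spot_arcs = {(u, v) \<in> parcs G. (\<exists>b i. u = Spot b i) \<and> (\<exists>b i. v = Spot b i)}"

lemma burn_spot_arcs:
  assumes "B \<inter> parcs G \<subseteq> spot_arcs"
  shows "burn B (Spot b i) (Spot b' i') \<inter> parcs G \<subseteq> spot_arcs"
proof -
  have "{(Spot b i, Spot b' i'), (Spot b' i', Spot b i)} \<inter> parcs G \<subseteq> spot_arcs"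
    by (auto simp: spot_arcs_def)
  with assms show ?thesis unfolding burn_def by blast
qed

lemma not_burned:
  assumes "B \<inter> parcs G \<subseteq> spot_arcs" "(u, v) \<in> parcs G" "\<And>b i. v \<noteq> Spot b i" "u \<noteq> Spot b i"
  shows "(u, v) \<in> parcs G - burn B (Spot b i) w"
proof -
  have "(u, v) \<notin> spot_arcs" using assms(3) by (auto simp: spot_arcs_def)
  with assms(1,2) have "(u, v) \<notin> B" by blast
  with assms(2-4) show ?thesis unfolding burn_def by blast
qed

lemma valid_catch_escapee:
  assumes Q: "valid Q" and B: "B \<inter> parcs G \<subseteq> spot_arcs" and d: "d \<in> CL" "l \<le> k"
  shows "wins G k (\<lambda>i. Tr (Q i)) (Esc d g l) (burn B (Spot b i) (Esc d g l))"
proof -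
  from Q d obtain j where j: "j < k" "sat d (Q j)" "Q j \<in> X" by (auto simp: valid_def)
  with d have "(Tr (Q j), Esc d g l) \<in> parcs G" by simp
  from not_burned[OF B this] have "(Tr (Q j), Esc d g l) \<in> parcs G - burn B (Spot b i) (Esc d g l)"
    by simp
  with j(1) show ?thesis by (intro wins_catch[of j]) simp_all
qed

text \<open>Outer induction on the unburned edges between spots, inner induction along a path to the
  threat. Steps are reversible, so from wherever the robber changes sides the cops can return
  through \<open>X0\<close> to the other threat. All positions on the way are valid, hence a robber
  entering an exit or a threat vertex is caught in the next turn, and changing spots uses up an
  edge.\<close>

lemma wins_at_spot:
  assumes paths: "\<And>b. \<exists>Y. step\<^sup>*\<^sup>* X0 Y \<and> (\<exists>j<k. Y j = thr b)"
    and guard: "\<And>Q b. valid Q \<Longrightarrow> \<exists>j<k. Q j = thr b \<or> (Q j, thr b) \<in> E"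
    and reach: "step\<^sup>*\<^sup>* X0 Q" and r: "Spot b i \<in> V" and B: "B \<inter> parcs G \<subseteq> spot_arcs"
  shows "wins G k (\<lambda>i. Tr (Q i)) (Spot b i) B"
  using reach r B
proof (induction "card (spot_arcs - B)" arbitrary: Q b i B rule: less_induct)
  case less
  have "finite spot_arcs" using finite_arcs by (rule rev_finite_subset) (auto simp: spot_arcs_def)
  then have fin: "finite (spot_arcs - B)" by simp
  have "symp step" by (auto intro: sympI step_sym)
  then have "step\<^sup>*\<^sup>* Q X0" using less.prems(1) by (metis sympD symp_rtranclp)
  with paths[of b] obtain Y where "step\<^sup>*\<^sup>* Q Y" and Y: "\<exists>j<k. Y j = thr b"
    by (meson rtranclp_trans)
  \<comment> \<open>A robber who stays put adds a loop to the burned set. So the inner induction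
    lets \<open>B'\<close> vary and fixes only what is left of the spot arcs.\<close>
  from this(1) have "\<And>B'. \<lbrakk>step\<^sup>*\<^sup>* X0 Q; B' \<inter> parcs G \<subseteq> spot_arcs; spot_arcs - B' = spot_arcs - B\<rbrakk> \<Longrightarrow>
     wins G k (\<lambda>i. Tr (Q i)) (Spot b i) B'"
  proof (induction rule: converse_rtranclp_induct)
    case base
    from Y obtain j where j: "j < k" "Y j = thr b" by blast
    then have "(Tr (Y j), Spot b i) \<in> parcs G" using less.prems(2) thr_X by simp
    moreover from this have "(Tr (Y j), Spot b i) \<notin> B'" using base(2) by (auto simp: spot_arcs_def)
    ultimately show ?case using j by (intro wins_catch[of j]) (simp_all add: thr_X)
  next
    case (step Q Q1)
    have reach1: "step\<^sup>*\<^sup>* X0 Q1" using step.prems(1) step.hyps(1) by (rule rtranclp.rtrancl_into_rtrancl[of step X0 Q Q1])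
    have v1: "valid Q1" using step.hyps(1) by (simp add: step_def)
    show ?case
    proof (rule wins_move[OF finite_arcs])
      have "(Tr (Q j), Tr (Q1 j)) \<in> parcs G - B'" if "j < k" "(Q j, Q1 j) \<in> E" for j
        using that E_X step.prems(2) by (auto simp: spot_arcs_def)
      then show "cop_move (parcs G - B') k (\<lambda>i. Tr (Q i)) (\<lambda>i. Tr (Q1 i))"
        using step.hyps(1) by (auto simp: cop_move_def step_def)
    next
      fix r' assume r': "r' = Spot b i \<or> (Spot b i, r') \<in> parcs G - B'"
      show "wins G k (\<lambda>i. Tr (Q1 i)) r' (burn B' (Spot b i) r')"
      proof (cases "r' = Spot b i")
        case True
        have "spot_arcs - burn B' r' r' = spot_arcs - B'"
          using adj_irrefl by (auto simp: burn_def spot_arcs_def)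
        then show ?thesis
          using step.IH[OF reach1] burn_spot_arcs[OF step.prems(2)] step.prems(3) True by simp
      next
        case False
        then have arc: "(Spot b i, r') \<in> parcs G" and nb: "(Spot b i, r') \<notin> B'" using r' by auto
        show ?thesis
        proof (cases r')
          case (Tr x)
          then have x: "x = thr b" using arc by simp
          from guard[OF v1] obtain j where j: "j < k" "Q1 j = thr b \<or> (Q1 j, thr b) \<in> E" by blast
          then have "(Q1 j, thr b) \<in> E \<Longrightarrow> (Tr (Q1 j), Tr x) \<in> parcs G" using E_X x by simp
          then have "(Q1 j, thr b) \<in> E \<Longrightarrow> (Tr (Q1 j), r') \<in> parcs G - burn B' (Spot b i) r'"
            using not_burned[OF step.prems(2)] Tr by simp
          with j x Tr show ?thesis by (intro wins_catch[OF j(1)]) auto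
        next
          case (Esc d g l)
          then show ?thesis
            using valid_catch_escapee[OF v1 step.prems(2)] arc by simp
        next
          case (Spot b' i')
          have "(Spot b i, r') \<in> spot_arcs" using arc Spot by (auto simp: spot_arcs_def)
          then have "spot_arcs - burn B' (Spot b i) r' \<subset> spot_arcs - B"
            using nb step.prems(3) unfolding burn_def by blast
          then have "card (spot_arcs - burn B' (Spot b i) r') < card (spot_arcs - B)"
            using fin by (rule psubset_card_mono[rotated])
          then show ?thesis
            using less.hyps[OF _ reach1] burn_spot_arcs[OF step.prems(2)] arc unfolding Spot by simp
        qed (use arc in auto)
      qed
    qed
  qed
  then show ?case using less.prems by blast
qed

text \<open>
  Only a robber who starts inside a track has to be chased from Ctr, which is in no guarding set:
  the cop going there must not be needed to guard the exits of the robber's vertex.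
\<close>

lemma cops_win_bounded:
  assumes X0: "valid X0" and k: "0 < k"
    and paths: "\<And>b. \<exists>Y. step\<^sup>*\<^sup>* X0 Y \<and> (\<exists>j<k. Y j = thr b)"
    and guard: "\<And>Q b. valid Q \<Longrightarrow> \<exists>j<k. Q j = thr b \<or> (Q j, thr b) \<in> E"
    and robust: "\<And>v. v \<in> X \<Longrightarrow> \<exists>c<k. \<forall>d\<in>CL. sat d v \<longrightarrow> (\<exists>i<k. i \<noteq> c \<and> sat d (X0 i))"
  shows "\<exists>T. cops_win_within G k T"
proof (rule cops_win_within_if_wins)
  let ?P = "\<lambda>i. Tr (X0 i) :: ('a, 'd) vert"
  have XX: "X0 j \<in> X" if "j < k" for j using X0 that by (simp add: valid_def)
  show "finite (pverts G)" using finite_V by simp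
  show "\<forall>i<k. ?P i \<in> pverts G" using XX by simp
  fix r assume "r \<in> pverts G"
  then have r: "r \<in> V" by simp
  show "wins G k ?P r {}"
  proof (cases r)
    case (Spot b i)
    then show ?thesis using wins_at_spot[OF paths guard, of X0 b i "{}"] r by simp
  next
    case (Esc d g l)
    with r X0 obtain j where "j < k" "sat d (X0 j)" by (auto simp: valid_def)
    then show ?thesis using r XX Esc by (intro wins_catch[of j]) auto
  next
    case Ctr
    then show ?thesis using k XX by (intro wins_catch[of 0]) auto
  next
    case (Safe d g l)
    with r X0 obtain j where j: "j < k" "sat d (X0 j)" by (auto simp: valid_def)
    show ?thesis
    proof (rule wins_move[OF finite_arcs])
      show "cop_move (parcs G - {}) k ?P (?P(j := Esc d g l))"
        using j XX r Safe by (auto simp: cop_move_def)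
      fix r' assume "r' = r \<or> (r, r') \<in> parcs G - {}"
      then consider "r' = r" | "r' = Esc d g l" using adj_Safe adj_sym Safe by auto
      then show "wins G k (?P(j := Esc d g l)) r' (burn {} r r')"
      proof cases
        case 1
        then show ?thesis using j r Safe by (intro wins_catch[of j]) (auto simp: burn_def)
      next
        case 2
        then show ?thesis using j by (intro wins_catch[of j]) auto
      qed
    qed
  next
    case (Tr v)
    then have v: "v \<in> X" using r by simp
    show ?thesis
    proof (cases "\<exists>j<k. X0 j = v \<or> (X0 j, v) \<in> E")
      case True
      then obtain j where "j < k" "X0 j = v \<or> (X0 j, v) \<in> E" by blast
      then show ?thesis using Tr v XX by (intro wins_catch[of j]) auto
    next
      case False
      from robust[OF v] obtain c where c: "c < k"
        "\<forall>d\<in>CL. sat d v \<longrightarrow> (\<exists>i<k. i \<noteq> c \<and> sat d (X0 i))" by blast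
      show ?thesis
      proof (rule wins_move[OF finite_arcs])
        show "cop_move (parcs G - {}) k ?P (?P(c := Ctr))"
          using XX by (auto simp: cop_move_def)
        fix r' assume r': "r' = r \<or> (r, r') \<in> parcs G - {}"
        show "wins G k (?P(c := Ctr)) r' (burn {} r r')"
        proof (cases r')
          case (Tr u)
          then have "u \<in> X" using r' r v by auto
          then show ?thesis
            using Tr c \<open>r = Tr v\<close> by (intro wins_catch[of c]) (auto simp: burn_def)
        next
          case (Esc d g l)
          then have d: "d \<in> CL" "l \<le> k" "sat d v" using r' \<open>r = Tr v\<close> by auto
          with c obtain i where i: "i < k" "i \<noteq> c" "sat d (X0 i)" by blast
          \<comment> \<open>Hence the edge by which this cop reaches the exit is not the one the
            robber has just burned.\<close>
          then have "X0 i \<noteq> v" using False by blast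
          then show ?thesis
            using Esc i d XX \<open>r = Tr v\<close> by (intro wins_catch[of i]) (auto simp: burn_def)
        next
          case (Spot b i)
          then have "v = thr b" using r' \<open>r = Tr v\<close> by auto
          then show ?thesis using guard[OF X0, of b] False by blast
        next
          case Ctr
          then show ?thesis using c by (intro wins_catch[of c]) auto
        next
          case (Safe d g l)
          then show ?thesis using r' \<open>r = Tr v\<close> by auto
        qed
      qed
    qed
  qed
qed

end

section \<open>The Gray code on the tracks\<close>

text \<open>
  The first argument is the track.  While track j is at Carry j c, track j + 1 may pass between
  leaves a and a + 1 with a mod (2 * k) = c.  The cops move simultaneously, so if Carry were
  adjacent to a leaf, the cop on it could leave it in the same turn in which the next cop leaves the
  hub for a wrong leaf; Pre prevents this.  Thr b, on track k - 2, threatens the spots of side b.  It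
  is adjacent to that entire track, so that the robber can never enter it.
\<close>

datatype tv = Leaf nat nat | Hub nat nat | Pre nat nat | Carry nat nat | Thr bool

datatype clause = Track nat | Class nat nat | Still nat | Guard bool

instance tv :: countable by countable_datatype
instance clause :: countable by countable_datatype

locale counter =
  fixes k m :: nat
  assumes k3: "3 \<le> k" and m3: "3 \<le> m"
begin

fun trk :: "tv \<Rightarrow> nat" where
  "trk (Leaf j a) = j" | "trk (Hub j q) = j" | "trk (Pre j c) = j" | "trk (Carry j c) = j"
| "trk (Thr b) = k - 2"

fun in_X :: "tv \<Rightarrow> bool" where
  "in_X (Leaf j a) \<longleftrightarrow> j < k \<and> 1 \<le> a \<and> a \<le> m"
| "in_X (Hub j q) \<longleftrightarrow> 0 < j \<and> j < k \<and> q \<le> m div k"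
| "in_X (Pre j c) \<longleftrightarrow> j < k \<and> c < 2 * k"
| "in_X (Carry j c) \<longleftrightarrow> j < k \<and> c < 2 * k"
| "in_X (Thr b) \<longleftrightarrow> True"

text \<open>In a reflected code the lower tracks run upwards while the digit is odd, so the edge
  from an odd leaf to its successor belongs to the upper end. As \<open>2 * k\<close> is even, the
  residue \<open>c\<close> determines this parity.\<close>

definition endp :: "nat \<Rightarrow> nat" where
  "endp c = (if odd c then m else 1)"

fun lk :: "tv \<Rightarrow> tv \<Rightarrow> bool" where
  "lk (Leaf j a) (Leaf j' a') \<longleftrightarrow> j = 0 \<and> j' = 0 \<and> a' = Suc a"
| "lk (Leaf j a) (Hub j' q) \<longleftrightarrow> j = j' \<and> q * k \<le> a \<and> a \<le> q * k + k"
| "lk (Leaf j a) (Pre j' c) \<longleftrightarrow> j = j' \<and> a = endp c"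
| "lk (Pre j c) (Carry j' c') \<longleftrightarrow> j = j' \<and> c = c'"
| "lk (Thr b) (Thr b') \<longleftrightarrow> b \<noteq> b'"
| "lk (Thr b) (Leaf j a) \<longleftrightarrow> j = k - 2"
| "lk (Thr b) (Hub j a) \<longleftrightarrow> j = k - 2"
| "lk (Thr b) (Pre j a) \<longleftrightarrow> j = k - 2"
| "lk (Thr b) (Carry j a) \<longleftrightarrow> j = k - 2"
| "lk _ _ \<longleftrightarrow> False"

definition X :: "tv set" where "X = {x. in_X x}"

definition E :: "tv rel" where
  "E = {(x, y). in_X x \<and> in_X y \<and> (lk x y \<or> lk y x)}"

text \<open>Clauses are best read as exclusions. \<open>Class j c\<close>: with track
  \<open>j\<close> at \<open>Pre j c\<close> or \<open>Carry j c\<close>, the next track is on a hub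
  or on a leaf at an end of an edge of residue \<open>c\<close>. \<open>Still j\<close>: the next
  track is on a hub only while track \<open>j\<close> is at a \<open>Carry\<close>.
  \<open>Guard b\<close>: \<open>Thr b\<close> is occupied only while the top track is at a
  \<open>Pre\<close> of the matching end.\<close>

fun sat :: "clause \<Rightarrow> tv \<Rightarrow> bool" where
  "sat (Track j) x \<longleftrightarrow> trk x = j"
| "sat (Class j c) x \<longleftrightarrow> (trk x = j \<and> x \<noteq> Pre j c \<and> x \<noteq> Carry j c) \<or>
     (case x of Hub j' q \<Rightarrow> j' = Suc j
      | Leaf j' a \<Rightarrow> j' = Suc j \<and> (a mod (2 * k) = c \<or> a mod (2 * k) = Suc c mod (2 * k))
      | _ \<Rightarrow> False)"
| "sat (Still j) x \<longleftrightarrow> (case x of Hub j' q \<Rightarrow> False | Carry j' c \<Rightarrow> j' = j \<or> j' = Suc j | _ \<Rightarrow> trk x = Suc j)"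
| "sat (Guard b) x \<longleftrightarrow> (trk x = k - 2 \<and> x \<noteq> Thr b) \<or>
     (case x of Pre j c \<Rightarrow> j = k - 1 \<and> odd c = b | _ \<Rightarrow> False)"

definition CL :: "clause set" where
  "CL = Track ` {..<k} \<union> (\<lambda>(j, c). Class j c) ` ({..<k - 1} \<times> {..<2 * k}) \<union> Still ` {..<k - 1} \<union> range Guard"

lemma X_sub: "X \<subseteq> (\<lambda>(j, a). Leaf j a) ` ({..<k} \<times> {1..m}) \<union> ((\<lambda>(j, q). Hub j q) ` ({..<k} \<times> {..m div k}) \<union>
    ((\<lambda>(j, c). Pre j c) ` ({..<k} \<times> {..<2 * k}) \<union> ((\<lambda>(j, c). Carry j c) ` ({..<k} \<times> {..<2 * k}) \<union>
    {Thr True, Thr False})))" (is "_ \<subseteq> ?S")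
proof
  fix x assume "x \<in> X"
  then show "x \<in> ?S" by (cases x) (auto simp: X_def)
qed

lemma finite_X: "finite X"
  by (rule finite_subset[OF X_sub]) simp

lemma card_X: "card X \<le> (k + 1) * m + 4 * k * k + k + 2"
proof -
  have "card X \<le> k * m + (k * Suc (m div k) + (k * (2 * k) + (k * (2 * k) + 2)))"
    by (rule order_trans[OF card_mono[OF _ X_sub]], simp)
      (intro order_trans[OF card_Un_le] add_mono order_trans[OF card_image_le];
        simp add: card_cartesian_product)
  moreover have "k * Suc (m div k) \<le> k + m" by simp
  ultimately have "card X \<le> k * m + (k + m + (k * (2 * k) + (k * (2 * k) + 2)))" by linarith
  then show ?thesis by (simp add: algebra_simps)
qed

lemma finite_CL: "finite CL"
  by (simp add: CL_def)

lemma escape_graph: "escape_graph k X E CL sat Thr trk"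
proof
  show "finite X" by (rule finite_X)
  show "finite CL" by (rule finite_CL)
  show "(x, y) \<in> E \<Longrightarrow> x \<in> X \<and> y \<in> X" for x y by (auto simp: E_def X_def)
  show "(x, y) \<in> E \<Longrightarrow> (y, x) \<in> E" for x y by (auto simp: E_def)
  show "(x, x) \<notin> E" for x by (cases x) (auto simp: E_def)
  show "(x, y) \<in> E \<Longrightarrow> trk x = trk y" for x y by (cases x; cases y) (auto simp: E_def)
  show "x \<in> X \<Longrightarrow> trk x < k" for x using k3 by (cases x) (auto simp: X_def)
  show "j < k \<Longrightarrow> \<exists>d\<in>CL. \<forall>x\<in>X. sat d x \<longleftrightarrow> trk x = j" for j
    by (intro bexI[of _ "Track j"]) (auto simp: CL_def)
qed (auto simp: X_def)

end

sublocale counter \<subseteq> escape_graph k X E CL sat Thr trk sz for sz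
  by (rule escape_graph)

context counter
begin

section \<open>Validity as a condition on neighbouring tracks\<close>

definition pair_ok :: "nat \<Rightarrow> tv \<Rightarrow> tv \<Rightarrow> bool" where
  "pair_ok j x y \<longleftrightarrow> (\<forall>c<2 * k. sat (Class j c) x \<or> sat (Class j c) y) \<and> (sat (Still j) x \<or> sat (Still j) y)"

lemma valid_iff:
  "valid Q \<longleftrightarrow> (\<forall>j<k. in_X (Q j) \<and> trk (Q j) = j) \<and> (\<forall>j. Suc j < k \<longrightarrow> pair_ok j (Q j) (Q (Suc j))) \<and>
     (\<forall>b. sat (Guard b) (Q (k - 2)) \<or> sat (Guard b) (Q (k - 1)))"
proof (intro iffI conjI)
  assume v: "valid Q"
  have cl: "\<exists>i<k. sat d (Q i) \<and> in_X (Q i) \<and> trk (Q i) = i" if "d \<in> CL" for d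
    using v that unfolding valid_def by (simp add: X_def) blast
  show "\<forall>j<k. in_X (Q j) \<and> trk (Q j) = j" using v unfolding valid_def by (simp add: X_def)
  show "\<forall>j. Suc j < k \<longrightarrow> pair_ok j (Q j) (Q (Suc j))"
    unfolding pair_ok_def
  proof (intro allI impI conjI)
    fix j c assume j: "Suc j < k" "c < 2 * k"
    then have "Class j c \<in> CL" by (auto simp: CL_def)
    from cl[OF this] obtain i where i: "i < k" "sat (Class j c) (Q i)" "trk (Q i) = i" by blast
    then have "i = j \<or> i = Suc j" by (cases "Q i") auto
    with i(2) show "sat (Class j c) (Q j) \<or> sat (Class j c) (Q (Suc j))" by metis
  next
    fix j assume j: "Suc j < k"
    then have "Still j \<in> CL" by (auto simp: CL_def)
    from cl[OF this] obtain i where i: "i < k" "sat (Still j) (Q i)" "trk (Q i) = i" by blast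
    then have "i = j \<or> i = Suc j" by (cases "Q i") auto
    with i(2) show "sat (Still j) (Q j) \<or> sat (Still j) (Q (Suc j))" by metis
  qed
  show "\<forall>b. sat (Guard b) (Q (k - 2)) \<or> sat (Guard b) (Q (k - 1))"
  proof
    fix b
    have "Guard b \<in> CL" by (auto simp: CL_def)
    from cl[OF this] obtain i where i: "i < k" "sat (Guard b) (Q i)" "trk (Q i) = i" by blast
    then have "i = k - 2 \<or> i = k - 1" by (cases "Q i") auto
    with i(2) show "sat (Guard b) (Q (k - 2)) \<or> sat (Guard b) (Q (k - 1))" by metis
  qed
next
  assume a: "(\<forall>j<k. in_X (Q j) \<and> trk (Q j) = j) \<and> (\<forall>j. Suc j < k \<longrightarrow> pair_ok j (Q j) (Q (Suc j))) \<and>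
     (\<forall>b. sat (Guard b) (Q (k - 2)) \<or> sat (Guard b) (Q (k - 1)))"
  show "valid Q"
    unfolding valid_def
  proof (intro conjI ballI)
    show "\<forall>j<k. Q j \<in> X \<and> trk (Q j) = j" using a by (simp add: X_def)
    fix d assume "d \<in> CL"
    then consider j where "j < k" "d = Track j" | j c where "Suc j < k" "c < 2 * k" "d = Class j c"
      | j where "Suc j < k" "d = Still j" | b where "d = Guard b"
      by (auto simp: CL_def less_diff_conv)
    then show "\<exists>j<k. sat d (Q j)"
    proof cases
      case 1
      then show ?thesis using a by auto
    next
      case 2
      then have "sat d (Q j) \<or> sat d (Q (Suc j))" using a unfolding pair_ok_def by blast
      then show ?thesis using 2(1) Suc_lessD by blast
    next
      case 3
      then have "sat d (Q j) \<or> sat d (Q (Suc j))" using a unfolding pair_ok_def by blast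
      then show ?thesis using 3(1) Suc_lessD by blast
    next
      case 4
      then have "sat d (Q (k - 2)) \<or> sat d (Q (k - 1))" using a by blast
      moreover have "k - 2 < k" "k - 1 < k" using k3 by auto
      ultimately show ?thesis by blast
    qed
  qed
qed

lemma validD:
  assumes "valid Q"
  shows "j < k \<Longrightarrow> in_X (Q j)" "j < k \<Longrightarrow> trk (Q j) = j"
    "Suc j < k \<Longrightarrow> pair_ok j (Q j) (Q (Suc j))" "sat (Guard b) (Q (k - 2)) \<or> sat (Guard b) (Q (k - 1))"
  using assms unfolding valid_iff by blast+

lemma hub_needs_carry:
  assumes v: "valid Q" and j: "Suc j < k" and h: "Q (Suc j) = Hub i q"
  shows "\<exists>c<2 * k. Q j = Carry j c"
  using validD(1,2)[OF v, of j] validD(3)[OF v j] j h by (cases "Q j") (auto simp: pair_ok_def)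

lemma carry_class:
  assumes v: "valid Q" and j: "Suc j < k" and c: "Q j = Pre j c \<or> Q j = Carry j c" and l: "Q (Suc j) = Leaf i a"
  shows "c < 2 * k \<and> (a mod (2 * k) = c \<or> a mod (2 * k) = Suc c mod (2 * k))"
proof -
  have "c < 2 * k" using validD(1)[OF v, of j] c j by auto
  moreover have "sat (Class j c) (Q j) \<or> sat (Class j c) (Q (Suc j))"
    using validD(3)[OF v j] calculation by (simp add: pair_ok_def)
  moreover have "i = Suc j" using validD(2)[OF v j] l by simp
  ultimately show ?thesis using c l by auto
qed

text \<open>Being joined to all of track \<open>k - 2\<close>, the threats look like a shortcut for
  that digit. They are none for the code as a whole: the top track is then at a \<open>Pre\<close>,
  where its rank ignores the lower tracks.\<close>

lemma thr_top:
  assumes v: "valid Q" and t: "Q j = Thr b" "j < k"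
  shows "j = k - 2 \<and> (\<exists>c. Q (Suc j) = Pre (k - 1) c \<and> odd c = b)"
proof -
  have j: "j = k - 2" "Suc j = k - 1" using validD(2)[OF v t(2)] t k3 by auto
  have "sat (Guard b) (Q (k - 2)) \<or> sat (Guard b) (Q (k - 1))" by (rule validD(4)[OF v])
  moreover have "trk (Q (k - 1)) = k - 1" using validD(2)[OF v, of "k - 1"] k3 by simp
  ultimately show ?thesis using t j k3 by (cases "Q (k - 1)") auto
qed

section \<open>The rank as a potential\<close>

text \<open>The factor is \<open>m - 2\<close> because the first and the last leaf of a higher track
  are truncated away, so only its inner leaves carry a full run of the code below. On track 0 the
  rank counts the \<open>m - 1\<close> edges of a path.\<close>

definition mx :: "nat \<Rightarrow> nat" where
  "mx j = (m - 1) * (m - 2) ^ j"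

lemma mx_Suc: "mx (Suc j) = (m - 2) * mx j"
  by (simp add: mx_def)

text \<open>The leaf that can be left towards its successor through hub q while the lower track shows c.\<close>

definition lower_leaf :: "nat \<Rightarrow> nat \<Rightarrow> nat" where
  "lower_leaf q c = (LEAST a. q * k \<le> Suc a \<and> a mod (2 * k) = c)"

text \<open>A window of \<open>2 * k\<close> numbers contains each residue once. It starts at
  \<open>q * k - 1\<close>, one before the leaves of the hub: at leaf \<open>q * k\<close> the lower
  track may display the preceding edge, whose lower end is not joined to this hub.\<close>

lemma lower_leaf_eq:
  assumes "q * k \<le> Suc a" "Suc a < q * k + 2 * k"
  shows "lower_leaf q (a mod (2 * k)) = a"
  unfolding lower_leaf_def
proof (rule Least_equality)
  fix y assume y: "q * k \<le> Suc y \<and> y mod (2 * k) = a mod (2 * k)"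
  show "a \<le> y"
  proof (rule ccontr)
    assume "\<not> a \<le> y"
    then have "2 * k dvd a - y" using y mod_eq_dvd_iff_nat[of y a "2 * k"] by auto
    then have "2 * k \<le> a - y" using \<open>\<not> a \<le> y\<close> by (intro dvd_imp_le) auto
    then show False using y assms by linarith
  qed
qed (use assms in simp)

text \<open>
  The position in the reflected Gray code formed by the tracks 0, ..., j.  It is truncated at the
  first and the last leaf, so that it does not depend on the lower tracks there.
\<close>

primrec rank :: "nat \<Rightarrow> (nat \<Rightarrow> tv) \<Rightarrow> nat" where
  "rank 0 Q = (case Q 0 of Leaf _ a \<Rightarrow> min (mx 0) (a - 1)
     | Pre _ c \<Rightarrow> (if odd c then mx 0 else 0) | Carry _ c \<Rightarrow> (if odd c then mx 0 else 0) | _ \<Rightarrow> 0)"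
| "rank (Suc j) Q = (case Q (Suc j) of
       Leaf _ a \<Rightarrow> min (mx (Suc j)) (a * mx j + (if even a then mx j - rank j Q else rank j Q) - 2 * mx j)
     | Hub _ q \<Rightarrow> (case Q j of Carry _ c \<Rightarrow> min (mx (Suc j)) (Suc (lower_leaf q c) * mx j - 2 * mx j) | _ \<Rightarrow> 0)
     | Pre _ c \<Rightarrow> (if odd c then mx (Suc j) else 0) | Carry _ c \<Rightarrow> (if odd c then mx (Suc j) else 0) | _ \<Rightarrow> 0)"

lemma rank_le: "rank j Q \<le> mx j"
  by (cases j) (auto split: tv.splits)

lemma rank_Pre: "Q j = Pre i c \<or> Q j = Carry i c \<Longrightarrow> rank j Q = (if odd c then mx j else 0)"
  by (cases j) auto

lemma rank_leaf_end: "Q j = Leaf i (endp c) \<Longrightarrow> rank j Q = (if odd c then mx j else 0)"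
proof (cases j)
  case 0
  then show "Q j = Leaf i (endp c) \<Longrightarrow> ?thesis" using m3 by (auto simp: endp_def mx_def)
next
  case (Suc j')
  have "m * mx j' = mx (Suc j') + 2 * mx j'" using m3 by (simp add: mx_Suc diff_mult_distrib)
  then show "Q j = Leaf i (endp c) \<Longrightarrow> ?thesis"
    using Suc rank_le[of j' Q] by (auto simp: endp_def)
qed

text \<open>Apart from the threats, \<open>Carry j c\<close> is adjacent only to
  \<open>Pre j c\<close>, so the lower track showed \<open>c\<close> already before the move. The
  leaf is therefore an end of the edge displayed; with the lower track at its own end, reflection
  gives both ends of that edge the same rank, which is the rank assigned to the hub.\<close>

lemma rank_hub:
  assumes v: "valid Q" and v': "valid Q'" and j: "Suc j < k"
    and l: "Q (Suc j) = Leaf (Suc j) a" and h: "Q' (Suc j) = Hub (Suc j) q"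
    and qa: "q * k \<le> a" "a \<le> q * k + k" and lower: "Q' j = Q j \<or> (Q j, Q' j) \<in> E"
  shows "rank (Suc j) Q = rank (Suc j) Q'"
proof -
  obtain c where c: "c < 2 * k" "Q' j = Carry j c" using hub_needs_carry[OF v' j h] by blast
  have "Q j \<noteq> Thr b" for b using thr_top[OF v, of j b] j l by auto
  then have Qj: "Q j = Pre j c \<or> Q j = Carry j c"
    using lower c by (cases "Q j") (auto simp: E_def)
  have r: "rank j Q = (if odd c then mx j else 0)" using Qj by (rule rank_Pre)
  have a1: "1 \<le> a" using validD(1)[OF v j] l by simp
  from carry_class[OF v j Qj l] show ?thesis
  proof (elim conjE disjE)
    assume ac: "a mod (2 * k) = c"
    then have "lower_leaf q c = a" using lower_leaf_eq[of q a] qa k3 by simp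
    moreover have "even a \<longleftrightarrow> even c" using ac by (metis dvd_mod_iff dvd_triv_left)
    ultimately show ?thesis using l h c r by simp
  next
    assume ac: "a mod (2 * k) = Suc c mod (2 * k)"
    obtain a' where a': "a = Suc a'" using a1 by (cases a) auto
    have "a' mod (2 * k) = c mod (2 * k)" using ac a' by (simp add: nat_mod_eq_iff)
    then have a'c: "a' mod (2 * k) = c" using c(1) by simp
    then have "lower_leaf q c = a'" using lower_leaf_eq[of q a'] qa a' k3 by simp
    moreover have "even a' \<longleftrightarrow> even c" using a'c by (metis dvd_mod_iff dvd_triv_left)
    ultimately show ?thesis using l h c r a' by simp
  qed
qed

text \<open>Above track 0, a move of the top digit goes through a hub or stays at an end, and there
  the rank is constant. While that digit rests on a leaf, the rank follows the lower tracks forwards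
  or backwards; the backward case is why the bound is two-sided. Threats have only a default rank
  and are excluded; below a leaf \<open>thr_top\<close> rules them out.\<close>

lemma rank_lipschitz:
  assumes "step Q Q'" "j < k" "\<forall>b. Q j \<noteq> Thr b" "\<forall>b. Q' j \<noteq> Thr b"
  shows "rank j Q' \<le> Suc (rank j Q) \<and> rank j Q \<le> Suc (rank j Q')"
  using assms
proof (induction j arbitrary: Q Q')
  case 0
  have dir: "rank 0 Q' \<le> Suc (rank 0 Q) \<and> rank 0 Q \<le> Suc (rank 0 Q')"
    if "lk (Q 0) (Q' 0)" "in_X (Q 0)" "in_X (Q' 0)" "\<forall>b. Q 0 \<noteq> Thr b"
      "trk (Q 0) = 0" "trk (Q' 0) = 0" for Q Q'
    using that rank_leaf_end[of Q 0] by (cases "Q 0"; cases "Q' 0") (auto simp: rank_Pre)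
  from 0 have "Q' 0 = Q 0 \<or> (Q 0, Q' 0) \<in> E" by (auto simp: step_def)
  then consider "Q' 0 = Q 0" | "lk (Q 0) (Q' 0)" "in_X (Q 0)" "in_X (Q' 0)"
    | "lk (Q' 0) (Q 0)" "in_X (Q 0)" "in_X (Q' 0)" by (auto simp: E_def)
  moreover have "trk (Q 0) = 0" "trk (Q' 0) = 0" using 0 by (auto simp: step_def valid_iff)
  ultimately show ?case
    using dir[of Q Q'] dir[of Q' Q] 0(3,4) by cases auto
next
  case (Suc j)
  have dir: "rank (Suc j) Q' \<le> Suc (rank (Suc j) Q) \<and> rank (Suc j) Q \<le> Suc (rank (Suc j) Q')"
    if st: "step Q Q'" and l: "lk (Q (Suc j)) (Q' (Suc j))" "\<forall>b. Q (Suc j) \<noteq> Thr b" for Q Q'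
  proof -
    have v: "valid Q" "valid Q'" and lower: "Q' j = Q j \<or> (Q j, Q' j) \<in> E"
      using st Suc.prems(2) by (auto simp: step_def)
    have t: "trk (Q (Suc j)) = Suc j" "trk (Q' (Suc j)) = Suc j"
      using validD(2)[OF v(1)] validD(2)[OF v(2)] Suc.prems(2) by auto
    show ?thesis
    proof (cases "\<exists>i q. Q' (Suc j) = Hub i q")
      case True
      then obtain q a where h: "Q' (Suc j) = Hub (Suc j) q" "Q (Suc j) = Leaf (Suc j) a"
        using l t by (cases "Q (Suc j)") auto
      then show ?thesis
        using rank_hub[OF v Suc.prems(2) h(2,1) _ _ lower] l by simp
    next
      case False
      then show ?thesis
        using l t rank_leaf_end[of Q "Suc j"]
        by (cases "Q (Suc j)"; cases "Q' (Suc j)") (auto simp del: rank.simps simp: rank_Pre)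
    qed
  qed
  have v: "valid Q" "valid Q'" and lower: "Q' j = Q j \<or> (Q j, Q' j) \<in> E"
    and same: "Q' (Suc j) = Q (Suc j) \<or> (Q (Suc j), Q' (Suc j)) \<in> E"
    using Suc.prems by (auto simp: step_def)
  from same consider "Q' (Suc j) = Q (Suc j)" | "lk (Q (Suc j)) (Q' (Suc j))" | "lk (Q' (Suc j)) (Q (Suc j))"
    by (auto simp: E_def)
  then show ?case
  proof cases
    case 1
    show ?thesis
    proof (cases "Q (Suc j)")
      case (Leaf i a)
      have "Q j \<noteq> Thr b" "Q' j \<noteq> Thr b" for b
        using thr_top[OF v(1), of j b] thr_top[OF v(2), of j b] Suc.prems(2) Leaf 1 by auto
      then have IH: "rank j Q' \<le> Suc (rank j Q) \<and> rank j Q \<le> Suc (rank j Q')"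
        using Suc.IH[OF Suc.prems(1)] Suc.prems(2) by simp
      have "min M (A + x - B) \<le> Suc (min M (A + y - B))" if "x \<le> Suc y" for M A B x y :: nat
        using that by auto
      then show ?thesis using IH Leaf 1 rank_le[of j Q] rank_le[of j Q'] by auto
    next
      case (Hub i q)
      obtain c where "Q j = Carry j c" using hub_needs_carry[OF v(1) Suc.prems(2) Hub] by blast
      moreover obtain c' where "Q' j = Carry j c'" using hub_needs_carry[OF v(2) Suc.prems(2)] 1 Hub by metis
      \<comment> \<open>Two \<open>Carry\<close> vertices are never adjacent, so the residue
        displayed cannot change while the hub is occupied.\<close>
      ultimately have "Q' j = Q j" using lower by (auto simp: E_def)
      then show ?thesis using 1 Hub by simp
    qed (use 1 Suc.prems in \<open>auto simp del: rank.simps simp: rank_Pre\<close>)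
  next
    case 2
    then show ?thesis using dir[OF Suc.prems(1)] Suc.prems by blast
  next
    case 3
    then show ?thesis using dir[OF step_sym[OF Suc.prems(1)]] Suc.prems by blast
  qed
qed


section \<open>Walking through the code\<close>

lemma pair_ok_Leaf [simp]: "pair_ok j (Leaf j a) y \<longleftrightarrow> sat (Still j) y"
  by (auto simp: pair_ok_def)

lemma pair_ok_Pre [simp]: "c < 2 * k \<Longrightarrow> pair_ok j (Pre j c) y \<longleftrightarrow> sat (Class j c) y \<and> sat (Still j) y"
  by (auto simp: pair_ok_def)

lemma pair_ok_Carry [simp]: "c < 2 * k \<Longrightarrow> pair_ok j (Carry j c) y \<longleftrightarrow> sat (Class j c) y"
  by (auto simp: pair_ok_def)

lemma pair_ok_Hub [simp]: "pair_ok j (Hub j q) y \<longleftrightarrow> sat (Still j) y"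
  by (auto simp: pair_ok_def)

definition at_leaves :: "nat \<Rightarrow> (nat \<Rightarrow> tv) \<Rightarrow> bool" where
  "at_leaves j Q \<longleftrightarrow> (\<forall>i\<le>j. \<exists>a. Q i = Leaf i a)"

lemma step_rtranclp_valid: "step\<^sup>*\<^sup>* Q Q' \<Longrightarrow> valid Q \<Longrightarrow> valid Q'"
  by (induction rule: rtranclp_induct) (auto simp: step_def)

lemma step_fun_upd:
  assumes "valid Q" "valid (Q(j := x))" "(Q j, x) \<in> E"
  shows "step Q (Q(j := x))"
  using assms by (auto simp: step_def)

text \<open>A leaf or a hub on track \<open>i\<close> demands only \<open>Still i\<close> from the
  next track, so the pair of tracks \<open>j\<close> and \<open>j + 1\<close> can be changed without
  regard to the others.\<close>

lemma valid_move_pair: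
  assumes v: "valid Q" and j: "Suc j < k" and al: "at_leaves (Suc j) Q"
    and u: "u = Leaf j b \<or> u = Pre j c \<or> u = Carry j c" and w: "w = Leaf (Suc j) b' \<or> w = Hub (Suc j) q"
    and X: "in_X u" "in_X w" and ok: "pair_ok j u w"
  shows "valid (Q(j := u, Suc j := w))" (is "valid ?Q")
  unfolding valid_iff
proof (intro conjI allI impI)
  fix i assume "i < k"
  then show "in_X (?Q i)" "trk (?Q i) = i" using validD(1,2)[OF v] u w X by auto
next
  fix i assume i: "Suc i < k"
  consider "Suc i = j" | "i = j" | "i = Suc j" | "Suc i \<noteq> j" "i \<noteq> j" "i \<noteq> Suc j" by blast
  then show "pair_ok i (?Q i) (?Q (Suc i))"
  proof cases
    case 1
    moreover have "\<exists>a. Q i = Leaf i a" using al 1 by (simp add: at_leaves_def)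
    ultimately show ?thesis using u by auto
  next
    case 2
    then show ?thesis using ok by simp
  next
    case 3
    moreover obtain a where "Q (Suc j) = Leaf (Suc j) a" using al by (auto simp: at_leaves_def)
    ultimately have "sat (Still (Suc j)) (Q (Suc i))" using validD(3)[OF v i] by simp
    then show ?thesis using 3 w by auto
  next
    case 4
    then show ?thesis using validD(3)[OF v i] by auto
  qed
next
  fix b
  show "sat (Guard b) (?Q (k - 2)) \<or> sat (Guard b) (?Q (k - 1))"
  proof (cases "k - 2 = j \<or> k - 2 = Suc j")
    case True
    then show ?thesis using u w by auto
  next
    case False
    then have "k - 2 \<noteq> j" "k - 2 \<noteq> Suc j" "k - 1 \<noteq> j" "k - 1 \<noteq> Suc j" using j k3 by auto
    then show ?thesis using validD(4)[OF v, of b] by simp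
  qed
qed

lemma endp_bounds: "1 \<le> endp c" "endp c \<le> m"
  using m3 by (auto simp: endp_def)

lemma carry_walk:
  assumes v: "valid Q" and j: "Suc j < k" and al: "at_leaves (Suc j) Q"
    and x: "1 \<le> x" "Suc x \<le> m" and ab: "(a = x \<and> b = Suc x) \<or> (a = Suc x \<and> b = x)"
    and Qj: "Q j = Leaf j (endp (x mod (2 * k)))" and Qs: "Q (Suc j) = Leaf (Suc j) a"
  shows "step\<^sup>*\<^sup>* Q (Q(Suc j := Leaf (Suc j) b))"
proof -
  define c where "c = x mod (2 * k)"
  \<comment> \<open>The hub whose range contains both \<open>x\<close> and
    \<open>Suc x\<close>.\<close>
  define q where "q = x div k"
  have c: "c < 2 * k" using k3 by (simp add: c_def)
  have xq: "q * k \<le> x" "Suc x \<le> q * k + k"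
  proof -
    have "x = q * k + x mod k" "x mod k < k" using k3 by (simp_all add: q_def)
    then show "q * k \<le> x" "Suc x \<le> q * k + k" by linarith+
  qed
  have qm: "q \<le> m div k" using x by (simp add: q_def div_le_mono)
  let ?C = "\<lambda>u w. Q(j := u, Suc j := w)"
  have cls: "sat (Class j c) (Leaf (Suc j) a)" "sat (Class j c) (Leaf (Suc j) b)"
    "sat (Class j c) (Hub (Suc j) q)"
    using ab by (auto simp: c_def mod_Suc_eq)
  have ab': "1 \<le> a" "a \<le> m" "1 \<le> b" "b \<le> m" "q * k \<le> a" "a \<le> q * k + k" "q * k \<le> b" "b \<le> q * k + k"
    using ab x xq by auto
  note val = valid_move_pair[OF v j al]
  have ends: "1 \<le> endp c" "endp c \<le> m" by (rule endp_bounds)+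
  have V: "valid (?C (Leaf j (endp c)) (Leaf (Suc j) a))" "valid (?C (Pre j c) (Leaf (Suc j) a))"
     "valid (?C (Carry j c) (Leaf (Suc j) a))" "valid (?C (Carry j c) (Hub (Suc j) q))"
     "valid (?C (Carry j c) (Leaf (Suc j) b))" "valid (?C (Pre j c) (Leaf (Suc j) b))"
     "valid (?C (Leaf j (endp c)) (Leaf (Suc j) b))"
    using j c cls ab' ends qm by (auto intro!: val simp del: sat.simps(2))
  have "step (?C (Leaf j (endp c)) (Leaf (Suc j) a)) (?C (Pre j c) (Leaf (Suc j) a))"
    "step (?C (Pre j c) (Leaf (Suc j) a)) (?C (Carry j c) (Leaf (Suc j) a))"
    "step (?C (Carry j c) (Leaf (Suc j) a)) (?C (Carry j c) (Hub (Suc j) q))"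
    "step (?C (Carry j c) (Hub (Suc j) q)) (?C (Carry j c) (Leaf (Suc j) b))"
    "step (?C (Carry j c) (Leaf (Suc j) b)) (?C (Pre j c) (Leaf (Suc j) b))"
    "step (?C (Pre j c) (Leaf (Suc j) b)) (?C (Leaf j (endp c)) (Leaf (Suc j) b))"
    using V j c ab' ends qm unfolding step_def by (auto simp: E_def)
  then have "step\<^sup>*\<^sup>* (?C (Leaf j (endp c)) (Leaf (Suc j) a)) (?C (Leaf j (endp c)) (Leaf (Suc j) b))"
    by (meson converse_rtranclp_into_rtranclp rtranclp.rtrancl_refl)
  moreover have "Q(j := Leaf j (endp c)) = Q" using Qj by (auto simp: c_def)
  moreover have "Q(Suc j := Leaf (Suc j) a) = Q" using Qs by auto
  ultimately show ?thesis by simp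
qed

lemma walk_by_steps:
  fixes P :: "nat \<Rightarrow> (nat \<Rightarrow> tv) \<Rightarrow> bool"
  assumes one: "\<And>Q a b. \<lbrakk>P a Q; 1 \<le> a; a \<le> m; 1 \<le> b; b \<le> m; b = Suc a \<or> a = Suc b\<rbrakk> \<Longrightarrow> \<exists>Q'. step\<^sup>*\<^sup>* Q Q' \<and> P b Q'"
    and P: "P a Q" and a: "1 \<le> a" "a \<le> m" and b: "1 \<le> b" "b \<le> m"
  shows "\<exists>Q'. step\<^sup>*\<^sup>* Q Q' \<and> P b Q'"
  using P a
proof (induction "(a - b) + (b - a)" arbitrary: a Q)
  case 0
  then show ?case by (intro exI[of _ Q]) auto
next
  case (Suc n)
  define a' where "a' = (if a < b then Suc a else a - 1)"
  have a': "1 \<le> a'" "a' \<le> m" "a' = Suc a \<or> a = Suc a'" "n = (a' - b) + (b - a')"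
    using Suc.hyps(2) Suc.prems b by (auto simp: a'_def)
  from one[OF Suc.prems(1) Suc.prems(2,3) a'(1-3)] obtain Q1 where Q1: "step\<^sup>*\<^sup>* Q Q1" "P a' Q1" by blast
  from Suc.hyps(1)[OF a'(4) Q1(2) a'(1,2)] obtain Q' where "step\<^sup>*\<^sup>* Q1 Q'" "P b Q'" by blast
  with Q1(1) show ?case by (meson rtranclp_trans)
qed

text \<open>Before every unit step of track \<open>j + 1\<close> the induction hypothesis brings
  track \<open>j\<close> to the end which that step requires. Upward and downward steps share an
  edge, so the lower of the two leaves decides.\<close>

lemma walk_to_leaf:
  assumes "j < k" "valid Q" "at_leaves j Q" "1 \<le> e" "e \<le> m"
  shows "\<exists>Q'. step\<^sup>*\<^sup>* Q Q' \<and> valid Q' \<and> at_leaves j Q' \<and> Q' j = Leaf j e \<and> (\<forall>i>j. Q' i = Q i)"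
  using assms
proof (induction j arbitrary: Q e)
  case 0
  define P where "P a Q' \<longleftrightarrow> valid Q' \<and> Q' 0 = Leaf 0 a \<and> (\<forall>i>0. Q' i = Q i)" for a Q'
  obtain a where a: "Q 0 = Leaf 0 a" using 0 by (auto simp: at_leaves_def)
  then have "P a Q" "1 \<le> a" "a \<le> m" using 0 validD(1)[of Q 0] by (auto simp: P_def)
  moreover have "\<exists>Q2. step\<^sup>*\<^sup>* Q1 Q2 \<and> P b Q2"
    if P: "P a Q1" and ab: "1 \<le> a" "a \<le> m" "1 \<le> b" "b \<le> m" "b = Suc a \<or> a = Suc b" for Q1 a b
  proof -
    have v: "valid Q1" and Q1: "Q1 0 = Leaf 0 a" using P by (auto simp: P_def)
    have "pair_ok 0 (Leaf 0 a) (Q1 (Suc 0))" using validD(3)[OF v, of 0] Q1 k3 by simp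
    then have "pair_ok 0 (Leaf 0 b) (Q1 (Suc 0))" by simp
    then have v2: "valid (Q1(0 := Leaf 0 b))"
      using v ab k3 unfolding valid_iff by auto
    have "step Q1 (Q1(0 := Leaf 0 b))"
      using ab k3 by (intro step_fun_upd v v2) (auto simp: Q1 E_def)
    moreover have "P b (Q1(0 := Leaf 0 b))" using P v2 by (auto simp: P_def)
    ultimately show ?thesis by blast
  qed
  ultimately obtain Q' where "step\<^sup>*\<^sup>* Q Q'" "P e Q'"
    using walk_by_steps[of P a Q e] 0(4,5) by blast
  then show ?case by (auto simp: P_def at_leaves_def)
next
  case (Suc j)
  define P where "P a Q' \<longleftrightarrow> valid Q' \<and> at_leaves (Suc j) Q' \<and> Q' (Suc j) = Leaf (Suc j) a \<and>
    (\<forall>i>Suc j. Q' i = Q i)" for a Q'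
  obtain a where a: "Q (Suc j) = Leaf (Suc j) a" using Suc.prems by (auto simp: at_leaves_def)
  then have "P a Q" "1 \<le> a" "a \<le> m" using Suc.prems validD(1)[of Q "Suc j"] by (auto simp: P_def)
  moreover have "\<exists>Q2. step\<^sup>*\<^sup>* Q1 Q2 \<and> P b Q2"
    if P: "P a Q1" and ab: "1 \<le> a" "a \<le> m" "1 \<le> b" "b \<le> m" "b = Suc a \<or> a = Suc b" for Q1 a b
  proof -
    define x where "x = min a b"
    have x: "1 \<le> x" "Suc x \<le> m" "(a = x \<and> b = Suc x) \<or> (a = Suc x \<and> b = x)"
      using ab by (auto simp: x_def)
    have "valid Q1" "at_leaves j Q1" using P by (auto simp: P_def at_leaves_def)
    from Suc.IH[OF Suc_lessD[OF Suc.prems(1)] this endp_bounds]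
    obtain Q2 where Q2: "step\<^sup>*\<^sup>* Q1 Q2" "valid Q2" "at_leaves j Q2" "Q2 j = Leaf j (endp (x mod (2 * k)))"
      "\<forall>i>j. Q2 i = Q1 i" by blast
    have Q2s: "Q2 (Suc j) = Leaf (Suc j) a" using Q2(5) P by (simp add: P_def)
    have al: "at_leaves (Suc j) Q2" using Q2(3) Q2s by (auto simp: at_leaves_def le_Suc_eq)
    let ?Q3 = "Q2(Suc j := Leaf (Suc j) b)"
    have st: "step\<^sup>*\<^sup>* Q2 ?Q3" by (rule carry_walk[OF Q2(2) Suc.prems(1) al x Q2(4) Q2s])
    have "P b ?Q3"
      using step_rtranclp_valid[OF st Q2(2)] al Q2(5) P by (auto simp: P_def at_leaves_def)
    with Q2(1) st show ?thesis by (meson rtranclp_trans)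
  qed
  ultimately obtain Q' where "step\<^sup>*\<^sup>* Q Q'" "P e Q'"
    using walk_by_steps[of P a Q e] Suc.prems(4,5) by blast
  then show ?case by (auto simp: P_def)
qed

definition X0 :: "nat \<Rightarrow> tv" where
  "X0 j = Leaf j 1"

lemma valid_X0: "valid X0"
  unfolding valid_iff X0_def using m3 k3 by auto

lemma walk_to_threat: "\<exists>Y. step\<^sup>*\<^sup>* X0 Y \<and> (\<exists>j<k. Y j = Thr b)"
proof -
  define c :: nat where "c = (if b then 1 else 0)"
  have c: "c < 2 * k" "odd c \<longleftrightarrow> b" using k3 by (auto simp: c_def)
  have k: "k - 1 < k" "k - 2 < k" "Suc (k - 2) = k - 1" "k - 2 \<noteq> k - 1" using k3 by auto
  from walk_to_leaf[OF k(1) valid_X0 _ endp_bounds, of c] obtain Q where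
    Q: "step\<^sup>*\<^sup>* X0 Q" "valid Q" "at_leaves (k - 1) Q" "Q (k - 1) = Leaf (k - 1) (endp c)"
    by (auto simp: at_leaves_def X0_def)
  have lf: "\<exists>a. Q i = Leaf i a" if "i < k" for i using Q(3) that by (auto simp: at_leaves_def)
  let ?Q1 = "Q(k - 1 := Pre (k - 1) c)"
  let ?Q2 = "?Q1(k - 2 := Thr b)"
  have v1: "valid ?Q1"
    unfolding valid_iff
  proof (intro conjI allI impI)
    fix i assume "i < k"
    then show "in_X (?Q1 i)" "trk (?Q1 i) = i" using validD(1,2)[OF Q(2)] c k by auto
  next
    fix i assume i: "Suc i < k"
    with lf[of i] validD(3)[OF Q(2) i] show "pair_ok i (?Q1 i) (?Q1 (Suc i))" by auto
  next
    fix b'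
    show "sat (Guard b') (?Q1 (k - 2)) \<or> sat (Guard b') (?Q1 (k - 1))" using lf[of "k - 2"] k by auto
  qed
  have v2: "valid ?Q2"
    unfolding valid_iff
  proof (intro conjI allI impI)
    fix i assume "i < k"
    then show "in_X (?Q2 i)" "trk (?Q2 i) = i" using validD(1,2)[OF v1] by auto
  next
    fix i assume i: "Suc i < k"
    consider "i = k - 2" | "Suc i = k - 2" | "i \<noteq> k - 2" "Suc i \<noteq> k - 2" by blast
    then show "pair_ok i (?Q2 i) (?Q2 (Suc i))"
    proof cases
      case 1
      then show ?thesis using k by (auto simp: pair_ok_def)
    next
      case 2
      then show ?thesis using lf[of i] i by auto
    next
      case 3
      then show ?thesis using validD(3)[OF v1 i] by auto
    qed
  next
    fix b'
    show "sat (Guard b') (?Q2 (k - 2)) \<or> sat (Guard b') (?Q2 (k - 1))" using k c by auto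
  qed
  have "step Q ?Q1"
    using Q(4) k c endp_bounds by (intro step_fun_upd Q v1) (auto simp: E_def)
  moreover have "step ?Q1 ?Q2"
  proof (rule step_fun_upd[OF v1 v2])
    obtain a where "Q (k - 2) = Leaf (k - 2) a" using lf k by blast
    then show "(?Q1 (k - 2), Thr b) \<in> E"
      using validD(1)[OF Q(2), of "k - 2"] k by (auto simp: E_def)
  qed
  ultimately have "step\<^sup>*\<^sup>* X0 ?Q2" using Q(1) by (meson rtranclp.rtrancl_into_rtrancl)
  moreover have "?Q2 (k - 2) = Thr b" by simp
  ultimately show ?thesis using k(2) by blast
qed

lemma thr_adjacent:
  assumes v: "valid Q"
  shows "\<exists>j<k. Q j = Thr b \<or> (Q j, Thr b) \<in> E"
proof -
  have k: "k - 2 < k" using k3 by simp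
  show ?thesis
    using validD(1,2)[OF v k] k by (intro exI[of _ "k - 2"]) (cases "Q (k - 2)"; auto simp: E_def)
qed

text \<open>At \<open>X0\<close> the cop on track \<open>j\<close> guards all
  \<open>Class j c\<close>, the one on track \<open>j + 1\<close> guards \<open>Still j\<close>, and
  the one on \<open>k - 2\<close> both \<open>Guard b\<close>. So the top cop is essential only for
  \<open>Track (k - 1)\<close> and \<open>Still (k - 2)\<close>, which concern exactly the
  exceptions in \<open>c\<close>; for those cop 0 can go. By \<open>3 \<le> k\<close> the cops 0,
  \<open>k - 2\<close> and \<open>k - 1\<close> are distinct.\<close>

lemma spare_cop:
  assumes x: "x \<in> X"
  shows "\<exists>c<k. \<forall>d\<in>CL. sat d x \<longrightarrow> (\<exists>i<k. i \<noteq> c \<and> sat d (X0 i))"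
proof -
  define c where "c = (if trk x = k - 1 \<or> (\<exists>b. x = Carry (k - 2) b) then 0 else k - 1)"
  have k: "k - 1 < k" "k - 2 < k" "Suc (k - 2) = k - 1" "k - 2 \<noteq> k - 1" "k - 2 \<noteq> 0" "k - 1 \<noteq> 0" "0 < k" using k3 by auto
  have cw: "c \<noteq> k - 2" using k by (auto simp: c_def)
  have "\<exists>i<k. i \<noteq> c \<and> sat d (X0 i)" if d: "d \<in> CL" and s: "sat d x" for d
  proof (cases d)
    case (Track j)
    then have "j = trk x" "j < k" using s d by (auto simp: CL_def)
    moreover have "trk x \<noteq> c" using k by (cases x) (auto simp: c_def)
    ultimately show ?thesis using Track by (intro exI[of _ j]) (auto simp: X0_def)
  next
    case (Class j c')
    then have j: "j < k - 1" using d by (auto simp: CL_def)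
    have "j \<noteq> c" using s Class j k k3 by (cases x) (auto simp: c_def split: if_splits)
    then show ?thesis using Class j by (intro exI[of _ j]) (auto simp: X0_def)
  next
    case (Still j)
    then have j: "j < k - 1" using d by (auto simp: CL_def)
    have "Suc j \<noteq> c" using s Still j k by (cases x) (auto simp: c_def split: if_splits)
    then show ?thesis using Still j by (intro exI[of _ "Suc j"]) (auto simp: X0_def)
  next
    case (Guard b)
    then show ?thesis using cw k by (intro exI[of _ "k - 2"]) (auto simp: X0_def)
  qed
  moreover have "c < k" using k by (auto simp: c_def)
  ultimately show ?thesis by blast
qed

end

section \<open>Counting vertices and rounds\<close>

context counter
begin

lemma counter_game:
  assumes "\<And>b. m \<le> sz b"
  shows "counter_game k X E CL sat Thr trk sz (rank (k - 1)) (mx (k - 1)) m"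
proof -
  have k: "k - 1 < k" "k - 2 < k" "Suc (k - 2) = k - 1" using k3 by auto
  show ?thesis
  proof
    fix Q Q' assume st: "step Q Q'"
    then have v: "valid Q" "valid Q'" by (auto simp: step_def)
    have "Q (k - 1) \<noteq> Thr b" "Q' (k - 1) \<noteq> Thr b" for b
      using thr_top[OF v(1), of "k - 1" b] thr_top[OF v(2), of "k - 1" b] k3 by auto
    then show "rank (k - 1) Q' \<le> Suc (rank (k - 1) Q)"
      using rank_lipschitz[OF st k(1)] by simp
  next
    fix Q b assume v: "valid Q" and t: "Q (trk (Thr b)) = Thr b"
    from thr_top[OF v, of "k - 2" b] t k obtain c where "Q (k - 1) = Pre (k - 1) c" "odd c = b" by auto
    then show "rank (k - 1) Q = (if b then mx (k - 1) else 0)"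
      using rank_Pre[of Q "k - 1" "k - 1" c] by simp
  qed (use assms m3 rank_le in \<open>auto simp: mx_def\<close>)
qed

lemma card_CL: "card CL \<le> k + k * (2 * k) + k + 2"
proof -
  have "card CL \<le> ((card {..<k} + card ({..<k - 1} \<times> {..<2 * k})) + card {..<k - 1}) + card (UNIV :: bool set)"
    unfolding CL_def
    by (intro order_trans[OF card_Un_le] add_mono card_image_le) auto
  also have "\<dots> = k + (k - 1) * (2 * k) + (k - 1) + 2"
    by (simp add: card_cartesian_product)
  also have "\<dots> \<le> k + k * (2 * k) + k + 2"
    by (intro add_mono mult_right_mono) auto
  finally show ?thesis .
qed

lemma slow_graph:
  assumes n: "(k + 3) * m + (4 * k * k + k + 3 + 6 * (k + 1) * (2 * k * k + 2 * k + 2)) \<le> n"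
  shows "\<exists>G :: nat pair_pre_digraph. pair_graph G \<and> card (pverts G) = n \<and> cop_number G = k \<and>
    (m - 2) ^ (k + 2) \<le> capture_time G"
proof -
  have "6 * (k + 1) * card CL \<le> 6 * (k + 1) * (2 * k * k + 2 * k + 2)"
    using card_CL by (intro mult_left_mono) auto
  then have rest: "card X + 6 * (k + 1) * card CL + m + 1 + m \<le> n"
    using n card_X by (simp add: algebra_simps)
  \<comment> \<open>Additional spots on one side bring the number of vertices to exactly
    \<open>n\<close>; the trail uses only \<open>m\<close> spots on each side.\<close>
  define sz where "sz b = (if b then n - (card X + 6 * (k + 1) * card CL + m + 1) else m)" for b
  have "m \<le> n - (card X + 6 * (k + 1) * card CL + m + 1)" using rest by linarith
  then have "m \<le> sz b" for b by (simp only: sz_def split: if_split) simp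
  from counter_game[OF this] interpret g: counter_game k X E CL sat Thr trk sz "rank (k - 1)" "mx (k - 1)" m .
  let ?G = "escape_graph.G k X E CL sat Thr sz" and ?f = "to_nat :: (tv, clause) vert \<Rightarrow> nat"
  have wf: "parcs ?G \<subseteq> pverts ?G \<times> pverts ?G" and inj: "inj_on ?f (pverts ?G)"
    by (auto simp: G_def intro: inj_on_subset[OF inj_to_nat])
  have card: "card (pverts ?G) = n"
    using card_V[of sz] rest by (simp add: sz_def)
  obtain T where T: "cops_win_within ?G k T"
    using cops_win_bounded[OF valid_X0 _ walk_to_threat thr_adjacent spare_cop] k3 by auto
  have num: "cop_number ?G = k"
    unfolding cop_number_def
  proof (rule Least_equality)
    show "cops_win ?G k" using T by (rule cops_win_if_within)
    show "k \<le> n" if "cops_win ?G n" for n using not_cops_win_less that by (meson not_less)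
  qed
  have "cops_win_within ?G k (capture_time ?G)"
    unfolding capture_time_def num using T by (rule LeastI)
  then have "(g.len - 2) * mx (k - 1) < capture_time ?G"
    using g.not_cops_win_within by (meson not_less)
  moreover have "(m - 2) ^ (k + 2) \<le> (g.len - 2) * mx (k - 1)"
  proof -
    have "m - 1 \<le> 2 * (m div 2)" by presburger
    then have "m * (m - 1) \<le> g.len"
      unfolding g.len_def by (metis mult.left_commute mult_le_mono2)
    moreover have "(m - 2) * (m - 2) \<le> m * (m - 1) - 2"
      using m3 by (auto simp: le_iff_add algebra_simps)
    ultimately have 1: "(m - 2) * (m - 2) \<le> g.len - 2" by linarith
    have "(m - 2) * (m - 2) ^ (k - 1) \<le> mx (k - 1)"
      unfolding mx_def by (intro mult_right_mono) auto
    with 1 have "(m - 2) * (m - 2) * ((m - 2) * (m - 2) ^ (k - 1)) \<le> (g.len - 2) * mx (k - 1)"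
      by (rule mult_le_mono)
    moreover have "(m - 2) * (m - 2) ^ (k - 1) = (m - 2) ^ k"
      using k3 by (simp add: power_eq_if)
    ultimately show ?thesis by (simp add: power_add power2_eq_square mult_ac)
  qed
  ultimately have "(m - 2) ^ (k + 2) \<le> capture_time ?G" by linarith
  then show ?thesis
    using pair_graph_image_graph[OF inj pair_graph_G] card_image[OF inj] card num
      cop_number_image_graph[OF inj wf] capture_time_image_graph[OF inj wf]
    by (intro exI[of _ "image_graph ?f ?G"]) (simp add: image_graph_def)
qed

end

theorem theorem1p1:
  shows "\<exists>C::real. C > 0 \<and>
    (\<forall>k::nat. k \<ge> 3 \<longrightarrow>
      (\<exists>N::nat. \<forall>n::nat. n \<ge> N \<longrightarrow>
        (\<exists>G :: nat pair_pre_digraph.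
           pair_graph G \<and> card (pverts G) = n \<and> cop_number G = k \<and>
           C * (real n ^ (k + 2) / real k ^ (k + 2)) \<le> real (capture_time G))))"
proof (intro exI[of _ "exp (-9) :: real"] conjI allI impI)
  fix k :: nat assume k: "3 \<le> k"
  define c where "c = 4 * k * k + k + 3 + 6 * (k + 1) * (2 * k * k + 2 * k + 2)"
  \<comment> \<open>Dividing by \<open>k + 4\<close> rather than \<open>k + 3\<close> leaves a spare
    \<open>m \<ge> c\<close> for the lower-order term. The summand \<open>3 * (k + 5)\<close>
    absorbs the rounding and the loss from \<open>m\<close> to \<open>m - 2\<close>, at the price of
    \<open>k + 5\<close> in place of \<open>k + 4\<close>.\<close>
  define N where "N = (k + 4) * (c + 3 + 3 * (k + 5))"
  show "\<exists>N. \<forall>n\<ge>N. \<exists>G :: nat pair_pre_digraph. pair_graph G \<and> card (pverts G) = n \<and> cop_number G = k \<and>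
      exp (-9) * (real n ^ (k + 2) / real k ^ (k + 2)) \<le> real (capture_time G)"
  proof (intro exI[of _ N] allI impI)
    fix n assume n: "N \<le> n"
    define m where "m = n div (k + 4)"
    have "N div (k + 4) \<le> m" unfolding m_def using n by (rule div_le_mono)
    then have m: "c + 3 + 3 * (k + 5) \<le> m" by (simp add: N_def)
    have "(k + 4) * m \<le> n" by (simp add: m_def)
    then have "(k + 3) * m + c \<le> n" using m by (simp add: algebra_simps)
    moreover have "counter k m" using k m by unfold_locales auto
    ultimately obtain G :: "nat pair_pre_digraph" where G: "pair_graph G" "card (pverts G) = n"
      "cop_number G = k" "(m - 2) ^ (k + 2) \<le> capture_time G"
      using counter.slow_graph[of k m n] unfolding c_def by blast
    have "n < (k + 4) * (m + 1)" 
    proof -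
      have "n = (k + 4) * m + n mod (k + 4)" "n mod (k + 4) < k + 4" by (simp_all add: m_def)
      then show ?thesis by (simp only: distrib_left mult_1_right)
    qed
    then have "real n \<le> real ((k + 4) * (m + 1))" by (simp only: of_nat_le_iff)
    also have "\<dots> = real (k + 4) * real (m - 2) + 3 * real (k + 4)"
      using m by (simp add: of_nat_diff algebra_simps)
    also have "\<dots> \<le> real (k + 5) * real (m - 2)"
      using m by (simp add: of_nat_diff algebra_simps)
    finally have "real n / real (k + 5) \<le> real (m - 2)" by (simp add: divide_le_eq mult.commute)
    then have "(real n / real (k + 5)) ^ (k + 2) \<le> real (m - 2) ^ (k + 2)"
      by (intro power_mono) auto
    also have "\<dots> \<le> real (capture_time G)" using G(4) by (metis of_nat_le_iff of_nat_power)
    finally have time: "(real n / real (k + 5)) ^ (k + 2) \<le> real (capture_time G)" .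
    have "(real (k + 5) / real k) ^ (k + 2) \<le> exp (5 / real k) ^ (k + 2)"
      using k exp_ge_add_one_self[of "5 / real k"] by (intro power_mono) (auto simp: add_divide_distrib)
    also have "\<dots> = exp (real (k + 2) * (5 / real k))" by (rule exp_of_nat_mult[symmetric])
    \<comment> \<open>The exponent is \<open>5 + 10 / k\<close>, which is below 9 for
      \<open>3 \<le> k\<close>.\<close>
    also have "\<dots> \<le> exp 9" using k by (simp add: field_simps)
    finally have "exp (-9) * (real (k + 5) / real k) ^ (k + 2) \<le> exp (-9) * exp 9"
      by (rule mult_left_mono) simp
    also have "\<dots> = 1" by (simp flip: exp_add)
    finally have "exp (-9) * (real (k + 5) / real k) ^ (k + 2) \<le> 1" .
    then have "(exp (-9) * (real (k + 5) / real k) ^ (k + 2)) * (real n / real (k + 5)) ^ (k + 2) \<le>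
        1 * (real n / real (k + 5)) ^ (k + 2)"
      by (intro mult_right_mono) auto
    also have "(exp (-9) * (real (k + 5) / real k) ^ (k + 2)) * (real n / real (k + 5)) ^ (k + 2) =
        exp (-9) * (real n ^ (k + 2) / real k ^ (k + 2))"
      using k by (simp add: power_divide del: of_nat_add)
    finally have "exp (-9) * (real n ^ (k + 2) / real k ^ (k + 2)) \<le> real (capture_time G)"
      using time by simp
    with G show "\<exists>G :: nat pair_pre_digraph. pair_graph G \<and> card (pverts G) = n \<and> cop_number G = k \<and>
      exp (-9) * (real n ^ (k + 2) / real k ^ (k + 2)) \<le> real (capture_time G)" by blast
  qed
qed simp

end
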